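(* Let $m,n\in\mathbb{N}$ with $n>m$, let $\pi_1$ be a permutation of $[m]=\{1,\dotsc,m\}$, let $\pi_2$ be a permutation of $\{m+1,\dotsc,n\}$, and let $\mu\in(\mathbb{Z}_{\ge0})^n$. Let $p=\sum_{i=m+1}^n\mu_i$. Then $$E_\mu^{\pi_1^c\pi_2^c}(x_1,\dotsc,x_n;q,t)=q^{-p}\,E_\mu^{\pi_1\pi_2}(x_m,\dotsc,x_1,qx_n,\dotsc,qx_{m+1};q^{-1},t^{-1}),$$ where the right side means $E_\mu^{\pi_1\pi_2}$ with $q,t$ replaced by $q^{-1},t^{-1}$ and the variables $(x_1,\dotsc,x_n)$ replaced by $(x_m,\dotsc,x_1,qx_n,\dotsc,qx_{m+1})$ respectively.
   Context: Concatenation: $\pi_1\pi_2\in S_n$ is the permutation with $(\pi_1\pi_2)(i)=\pi_1(i)$ for $i\le m$ and $=\pi_2(i)$ for $i>m$. Complement: for a permutation $\rho$ of $[a,b]=\{a,\dotsc,b\}$, $\rho^c$ is the permutation of $[a,b]$ given by $\rho^c(i)=a+b-\rho(i)$; thus $\pi_1^c(i)=m+1-\pi_1(i)$ and $\pi_2^c(i)=n+m+1-\pi_2(i)$. $S_n$ acts on $\mathbb{Q}(q,t)[x_1,\dotsc,x_n]$ by $\pi(x_i)=x_{\pi(i)}$. Demazure–Lusztig operators: $T_if=t\,\sigma_i(f)+(t-1)x_{i+1}\frac{\sigma_i(f)-f}{x_i-x_{i+1}}$ for $\sigma_i=(i,i+1)$, and $T_\pi=T_{i_1}\cdots T_{i_\ell}$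 for any reduced word $\pi=\sigma_{i_1}\cdots\sigma_{i_\ell}$. For $\pi\in S_n$ and $\mu\in(\mathbb{Z}_{\ge0})^n$, $\ell_\mu(\pi)$ is the number of pairs $i<j$ with $\pi(i)>\pi(j)$ and $\mu_i\le\mu_j$, and $E^\pi_\mu=t^{-\ell_\mu(\pi)}T_\pi E_\mu$. Nonsymmetric Macdonald polynomials $E_\mu$ (Haglund–Haiman–Loehr conventions): $\mathrm{dg}'(\mu)=\{(i,j):1\le i\le n,\ 1\le j\le\mu_i\}$ ($i$ = column, $j$ = row), $\hat{\mathrm{dg}}(\mu)=\mathrm{dg}'(\mu)\cup\{(i,0):1\le i\le n\}$. For $u=(i,j)\in\mathrm{dg}'(\mu)$: $d(u)=(i,j-1)$, $l(u)=\mu_i-j$, and $a(u)$ is the number of $(i',j)\in\mathrm{dg}'(\mu)$ with $i'<i$, $\mu_{i'}\le\mu_i$, plus the number of $(i',j-1)\in\hat{\mathrm{dg}}(\mu)$ with $i'>i$, $\mu_{i'}<\mu_i$. An augmented filling with basement $\pi\in S_n$ is a map $\hat\sigma:\hat{\mathrm{dg}}(\mu)\to[n]$ with $\hat\sigma(i,0)=\pi(i)$. Distinct boxes attack if in the same row or of the form $(i,j),(i',j-1)$ with $i'>i$; $\mathrm{NAF}^\pi_\mu$ is the set of such fillings with distinct values on attacking pairs. A descent is $u\in\mathrm{dg}'(\mu)$ with $\hat\sigma(u)>\hat\sigma(d(u))$; $\mathrm{maj}(\hat\sigma)=\sum_{u\text{ descent}}(l(u)+1)$. Reading order: rows from top to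 bottom, right to left within a row. An inversion is a pair of attacking boxes $u,v$, $u$ before $v$ in reading order, $\hat\sigma(u)>\hat\sigma(v)$. $\mathrm{inv}(\hat\sigma)=|\mathrm{Inv}(\hat\sigma)|-|\{i<j:\mu_i\le\mu_j,\ \pi(i)<\pi(j)\}|-\sum_{u\text{ descent}}a(u)$, $\mathrm{coinv}(\hat\sigma)=\sum_{u\in\mathrm{dg}'(\mu)}a(u)-\mathrm{inv}(\hat\sigma)$. Then $E_\mu(x;q,t)=\sum_{\hat\sigma\in\mathrm{NAF}^{\mathrm{id}}_\mu}x^{\hat\sigma}q^{\mathrm{maj}(\hat\sigma)}t^{\mathrm{coinv}(\hat\sigma)}\prod_{u\in\mathrm{dg}'(\mu),\ \hat\sigma(u)\ne\hat\sigma(d(u))}\frac{1-t}{1-q^{l(u)+1}t^{a(u)+1}}$ with $x^{\hat\sigma}=\prod_{u\in\mathrm{dg}'(\mu)}x_{\hat\sigma(u)}$. *)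

theory Defs
  imports
    "HOL-Library.Poly_Mapping"
    "HOL-Library.FuncSet"
    "HOL-Computational_Algebra.Polynomial"
    "HOL-Computational_Algebra.Fraction_Field"
    "HOL-Combinatorics.Permutations"
begin

text \<open>The field \<open>\<rat>(q,t)\<close> is the fraction field of \<open>\<rat>[q][t]\<close>: the inner polynomial variable
  is \<open>q\<close>, the outer one is \<open>t\<close>.\<close>

type_synonym ratfun = "rat poly poly fract"

definition qq :: ratfun where
  "qq = Fract [:[:0, 1:]:] 1"

definition tt :: ratfun where
  "tt = Fract [:0, 1:] 1"

definition rat_const :: "rat \<Rightarrow> ratfun" where
  "rat_const c = Fract [:[:c:]:] 1"

definition eval_qt :: "ratfun \<Rightarrow> ratfun \<Rightarrow> rat poly poly \<Rightarrow> ratfun" where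
  "eval_qt a b P = poly (map_poly (\<lambda>p. poly (map_poly rat_const p) a) P) b"

text \<open>The field endomorphism of \<open>\<rat>(q,t)\<close> replacing \<open>q, t\<close> by \<open>q\<^sup>-\<^sup>1, t\<^sup>-\<^sup>1\<close>. The value does not
  depend on the chosen fraction, since \<open>q\<^sup>-\<^sup>1, t\<^sup>-\<^sup>1\<close> are algebraically independent.\<close>

definition invert_qt :: "ratfun \<Rightarrow> ratfun" where
  "invert_qt z = (THE w. \<exists>P Q. Q \<noteq> 0 \<and> z = Fract P Q \<and>
     w = eval_qt (inverse qq) (inverse tt) P / eval_qt (inverse qq) (inverse tt) Q)"

text \<open>A polynomial over \<open>\<rat>(q,t)\<close> is a finitely supported function from exponent vectors to
  coefficients; the ring \<open>\<rat>(q,t)[x\<^sub>1,\<dots>,x\<^sub>n]\<close> sits inside as the polynomials that only involve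
  the variables with index in \<open>{1..n}\<close>.\<close>

type_synonym mpol = "(nat \<Rightarrow>\<^sub>0 nat) \<Rightarrow>\<^sub>0 ratfun"

definition cst :: "ratfun \<Rightarrow> mpol" where
  "cst c = Poly_Mapping.single 0 c"

definition xvar :: "nat \<Rightarrow> mpol" where
  "xvar i = Poly_Mapping.single (Poly_Mapping.single i 1) 1"

text \<open>Apply \<open>\<phi>\<close> to the coefficients and simultaneously replace each variable \<open>x\<^sub>i\<close> by \<open>s i\<close>.\<close>

definition subst_poly :: "(ratfun \<Rightarrow> ratfun) \<Rightarrow> (nat \<Rightarrow> mpol) \<Rightarrow> mpol \<Rightarrow> mpol" where
  "subst_poly \<phi> s f =
     (\<Sum>e\<in>Poly_Mapping.keys f. cst (\<phi> (Poly_Mapping.lookup f e)) *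
        (\<Prod>i\<in>Poly_Mapping.keys e. s i ^ Poly_Mapping.lookup e i))"

definition perm_act :: "(nat \<Rightarrow> nat) \<Rightarrow> mpol \<Rightarrow> mpol" where
  "perm_act \<pi> f = subst_poly (\<lambda>c. c) (\<lambda>i. xvar (\<pi> i)) f"

definition concat_perm :: "nat \<Rightarrow> (nat \<Rightarrow> nat) \<Rightarrow> (nat \<Rightarrow> nat) \<Rightarrow> nat \<Rightarrow> nat" where
  "concat_perm m \<pi>1 \<pi>2 i = (if i \<le> m then \<pi>1 i else \<pi>2 i)"

text \<open>The complement of a permutation of \<open>{a..b}\<close>; outside \<open>{a..b}\<close> it is the identity, as required
  by \<^const>\<open>permutes\<close>.\<close>

definition compl_perm :: "nat \<Rightarrow> nat \<Rightarrow> (nat \<Rightarrow> nat) \<Rightarrow> nat \<Rightarrow> nat" where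
  "compl_perm a b \<rho> i = (if i \<in> {a..b} then a + b - \<rho> i else i)"

definition word_perm :: "nat list \<Rightarrow> nat \<Rightarrow> nat" where
  "word_perm w = foldr (\<lambda>i \<pi>. transpose i (Suc i) \<circ> \<pi>) w id"

definition reduced_word :: "nat \<Rightarrow> (nat \<Rightarrow> nat) \<Rightarrow> nat list \<Rightarrow> bool" where
  "reduced_word n \<pi> w \<longleftrightarrow> set w \<subseteq> {1..<n} \<and> word_perm w = \<pi> \<and>
     (\<forall>w'. set w' \<subseteq> {1..<n} \<and> word_perm w' = \<pi> \<longrightarrow> length w \<le> length w')"

text \<open>\<open>(\<sigma>\<^sub>i(f) - f) / (x\<^sub>i - x\<^sub>i\<^sub>+\<^sub>1)\<close>: this quotient is a polynomial, unique because the polynomial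
  ring is an integral domain.\<close>

definition divided_diff :: "nat \<Rightarrow> mpol \<Rightarrow> mpol" where
  "divided_diff i f =
     (THE g. g * (xvar i - xvar (Suc i)) = perm_act (transpose i (Suc i)) f - f)"

definition demazure_lusztig :: "nat \<Rightarrow> mpol \<Rightarrow> mpol" where
  "demazure_lusztig i f = cst tt * perm_act (transpose i (Suc i)) f
     + cst (tt - 1) * xvar (Suc i) * divided_diff i f"

text \<open>The operators satisfy the braid relations, so the choice of reduced word is immaterial.\<close>

definition demazure_lusztig_perm :: "nat \<Rightarrow> (nat \<Rightarrow> nat) \<Rightarrow> mpol \<Rightarrow> mpol" where
  "demazure_lusztig_perm n \<pi> f = foldr demazure_lusztig (SOME w. reduced_word n \<pi> w) f"

text \<open>A weak composition \<open>\<mu>\<close> with \<open>n\<close> parts is a function on \<open>nat\<close> of which only the values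
  on \<open>{1..n}\<close> matter. A box is a pair (column, row).\<close>

type_synonym box = "nat \<times> nat"

definition dg :: "nat \<Rightarrow> (nat \<Rightarrow> nat) \<Rightarrow> box set" where
  "dg n \<mu> = {(i, j). 1 \<le> i \<and> i \<le> n \<and> 1 \<le> j \<and> j \<le> \<mu> i}"

definition dg_hat :: "nat \<Rightarrow> (nat \<Rightarrow> nat) \<Rightarrow> box set" where
  "dg_hat n \<mu> = dg n \<mu> \<union> {(i, 0) | i. 1 \<le> i \<and> i \<le> n}"

definition below :: "box \<Rightarrow> box" where
  "below u = (fst u, snd u - 1)"

definition leg :: "(nat \<Rightarrow> nat) \<Rightarrow> box \<Rightarrow> nat" where
  "leg \<mu> u = \<mu> (fst u) - snd u"

definition arm :: "nat \<Rightarrow> (nat \<Rightarrow> nat) \<Rightarrow> box \<Rightarrow> nat" where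
  "arm n \<mu> u =
     card {i'. (i', snd u) \<in> dg n \<mu> \<and> i' < fst u \<and> \<mu> i' \<le> \<mu> (fst u)} +
     card {i'. (i', snd u - 1) \<in> dg_hat n \<mu> \<and> i' > fst u \<and> \<mu> i' < \<mu> (fst u)}"

definition attacking :: "box \<Rightarrow> box \<Rightarrow> bool" where
  "attacking u v \<longleftrightarrow> u \<noteq> v \<and>
     (snd u = snd v \<or>
      (snd u = Suc (snd v) \<and> fst v > fst u) \<or>
      (snd v = Suc (snd u) \<and> fst u > fst v))"

definition NAF :: "nat \<Rightarrow> (nat \<Rightarrow> nat) \<Rightarrow> (nat \<Rightarrow> nat) \<Rightarrow> (box \<Rightarrow> nat) set" where
  "NAF n \<pi> \<mu> = {\<sigma> \<in> dg_hat n \<mu> \<rightarrow>\<^sub>E {1..n}.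
     (\<forall>i\<in>{1..n}. \<sigma> (i, 0) = \<pi> i) \<and>
     (\<forall>u\<in>dg_hat n \<mu>. \<forall>v\<in>dg_hat n \<mu>. attacking u v \<longrightarrow> \<sigma> u \<noteq> \<sigma> v)}"

definition descents :: "nat \<Rightarrow> (nat \<Rightarrow> nat) \<Rightarrow> (box \<Rightarrow> nat) \<Rightarrow> box set" where
  "descents n \<mu> \<sigma> = {u \<in> dg n \<mu>. \<sigma> u > \<sigma> (below u)}"

definition maj_stat :: "nat \<Rightarrow> (nat \<Rightarrow> nat) \<Rightarrow> (box \<Rightarrow> nat) \<Rightarrow> nat" where
  "maj_stat n \<mu> \<sigma> = (\<Sum>u\<in>descents n \<mu> \<sigma>. leg \<mu> u + 1)"

definition reads_before :: "box \<Rightarrow> box \<Rightarrow> bool" where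
  "reads_before u v \<longleftrightarrow> snd u > snd v \<or> (snd u = snd v \<and> fst u > fst v)"

definition inversion_pairs :: "nat \<Rightarrow> (nat \<Rightarrow> nat) \<Rightarrow> (box \<Rightarrow> nat) \<Rightarrow> (box \<times> box) set" where
  "inversion_pairs n \<mu> \<sigma> = {(u, v). u \<in> dg_hat n \<mu> \<and> v \<in> dg_hat n \<mu> \<and>
     attacking u v \<and> reads_before u v \<and> \<sigma> u > \<sigma> v}"

definition inv_stat :: "nat \<Rightarrow> (nat \<Rightarrow> nat) \<Rightarrow> (nat \<Rightarrow> nat) \<Rightarrow> (box \<Rightarrow> nat) \<Rightarrow> int" where
  "inv_stat n \<pi> \<mu> \<sigma> = int (card (inversion_pairs n \<mu> \<sigma>))
     - int (card {(i, j). 1 \<le> i \<and> i < j \<and> j \<le> n \<and> \<mu> i \<le> \<mu> j \<and> \<pi> i < \<pi> j})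
     - int (\<Sum>u\<in>descents n \<mu> \<sigma>. arm n \<mu> u)"

definition coinv_stat :: "nat \<Rightarrow> (nat \<Rightarrow> nat) \<Rightarrow> (nat \<Rightarrow> nat) \<Rightarrow> (box \<Rightarrow> nat) \<Rightarrow> int" where
  "coinv_stat n \<pi> \<mu> \<sigma> = int (\<Sum>u\<in>dg n \<mu>. arm n \<mu> u) - inv_stat n \<pi> \<mu> \<sigma>"

definition macdonald_E :: "nat \<Rightarrow> (nat \<Rightarrow> nat) \<Rightarrow> mpol" where
  "macdonald_E n \<mu> = (\<Sum>\<sigma>\<in>NAF n id \<mu>.
     cst (qq ^ maj_stat n \<mu> \<sigma> * tt powi coinv_stat n id \<mu> \<sigma> *
          (\<Prod>u\<in>{u \<in> dg n \<mu>. \<sigma> u \<noteq> \<sigma> (below u)}.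
             (1 - tt) / (1 - qq ^ (leg \<mu> u + 1) * tt ^ (arm n \<mu> u + 1)))) *
     (\<Prod>u\<in>dg n \<mu>. xvar (\<sigma> u)))"

definition ell :: "nat \<Rightarrow> (nat \<Rightarrow> nat) \<Rightarrow> (nat \<Rightarrow> nat) \<Rightarrow> nat" where
  "ell n \<mu> \<pi> = card {(i, j). 1 \<le> i \<and> i < j \<and> j \<le> n \<and> \<pi> i > \<pi> j \<and> \<mu> i \<le> \<mu> j}"

definition macdonald_E_perm :: "nat \<Rightarrow> (nat \<Rightarrow> nat) \<Rightarrow> (nat \<Rightarrow> nat) \<Rightarrow> mpol" where
  "macdonald_E_perm n \<pi> \<mu> =
     cst (tt powi (- int (ell n \<mu> \<pi>))) * demazure_lusztig_perm n \<pi> (macdonald_E n \<mu>)"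

end

theory Submission
  imports Defs
begin

text \<open>Process the boxes of a non-attacking filling row by row from the bottom, from left to right.
  All that matters for the future is the frontier: the list of columns, rotated so that the next
  column comes first, with the topmost value and the remaining height of each. The box on top of
  the first column attacks precisely the rest of the frontier, its arm consists of the frontier
  columns of smaller remaining height, and the coinversions it creates are read off the cyclic order
  of the values. This gives a one-box recursion for generating functions \<open>G\<close> of frontiers,
  and \<open>E\<^sub>\<mu> = G((1, \<mu>\<^sub>1), \<dots>, (n, \<mu>\<^sub>n))\<close>.

  By induction on the recursion, \<open>T\<^sub>i\<close> applied to \<open>G\<close> swaps the values \<open>i\<close> and \<open>i + 1\<close>, up to an
  explicit power of \<open>t\<close>, whenever \<open>i\<close> precedes \<open>i + 1\<close> in the frontier. Along a reduced word these
  powers add up to \<open>\<ell>\<^sub>\<mu>(\<pi>)\<close>, so \<open>E\<^sup>\<pi>\<^sub>\<mu> = G((\<pi>(1), \<mu>\<^sub>1), \<dots>, (\<pi>(n), \<mu>\<^sub>n))\<close>; no braid relation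
  is involved. Finally, complementing all values within the two blocks is a reflection of the cyclic order and
  hence exchanges coinversion triples with the other triples of distinct values, which matches
  inverting \<open>q\<close> and \<open>t\<close> one box at a time.\<close>

section \<open>The field automorphism inverting q and t\<close>

locale unital_ring_hom =
  fixes h :: "'a::comm_ring_1 \<Rightarrow> 'b::comm_ring_1"
  assumes hom_one [simp]: "h 1 = 1"
    and hom_add: "h (x + y) = h x + h y"
    and hom_mult: "h (x * y) = h x * h y"
begin

lemma hom_zero [simp]: "h 0 = 0"
  using hom_add[of 0 0] by simp

lemma hom_uminus: "h (- x) = - h x"
  using hom_add[of x "- x"] by (simp add: eq_neg_iff_add_eq_0 add.commute)

lemma hom_diff: "h (x - y) = h x - h y"
  using hom_add[of x "- y"] by (simp add: hom_uminus)

lemma hom_sum: "h (sum f A) = (\<Sum>a\<in>A. h (f a))"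
  by (induction A rule: infinite_finite_induct) (simp_all add: hom_add)

lemma hom_prod: "h (prod f A) = (\<Prod>a\<in>A. h (f a))"
  by (induction A rule: infinite_finite_induct) (simp_all add: hom_mult)

lemma hom_power: "h (x ^ k) = h x ^ k"
  by (induction k) (simp_all add: hom_mult)

text \<open>Mapping the coefficients by \<open>h\<close> may lower the degree, so the sum runs up to
  a bound for the degree of \<open>P\<close> itself; the additional terms vanish.\<close>

lemma poly_map_poly_eq:
  assumes "degree P \<le> N"
  shows "poly (map_poly h P) b = (\<Sum>k\<le>N. h (coeff P k) * b ^ k)"
proof -
  have "poly (map_poly h P) b = (\<Sum>k\<le>degree (map_poly h P). h (coeff P k) * b ^ k)"
    by (simp add: poly_altdef coeff_map_poly)
  also have "\<dots> = (\<Sum>k\<le>N. h (coeff P k) * b ^ k)"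
  proof (rule sum.mono_neutral_left)
    show "{..degree (map_poly h P)} \<subseteq> {..N}"
      using degree_le[of "degree P" "map_poly h P"] coeff_eq_0[of P] assms
      by (auto simp: coeff_map_poly)
    show "\<forall>k\<in>{..N} - {..degree (map_poly h P)}. h (coeff P k) * b ^ k = 0"
      using coeff_eq_0[of "map_poly h P"] by (auto simp: coeff_map_poly)
  qed simp
  finally show ?thesis .
qed

lemma poly_map_poly_hom: "unital_ring_hom (\<lambda>P. poly (map_poly h P) b)"
proof
  have add: "map_poly h (P + Q) = map_poly h P + map_poly h Q" for P Q
    by (rule poly_eqI) (simp add: coeff_map_poly hom_add)
  have mult: "map_poly h (P * Q) = map_poly h P * map_poly h Q" for P Q
    by (rule poly_eqI) (simp add: coeff_map_poly coeff_mult hom_sum hom_mult)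
  show "poly (map_poly h 1) b = 1" by simp
  show "poly (map_poly h (P + Q)) b = poly (map_poly h P) b + poly (map_poly h Q) b" for P Q
    by (simp add: add)
  show "poly (map_poly h (P * Q)) b = poly (map_poly h P) b * poly (map_poly h Q) b" for P Q
    by (simp add: mult)
qed

end

lemma to_fract_hom: "unital_ring_hom (\<lambda>P::'a::idom. Fract P 1)"
  by standard (simp_all add: One_fract_def)

lemma Fract_1_eq_iff [simp]: "Fract (P::'a::idom) 1 = Fract Q 1 \<longleftrightarrow> P = Q"
  by (simp add: eq_fract)

lemma Fract_1_eq_0_iff: "Fract (P::'a::idom) 1 = 0 \<longleftrightarrow> P = 0"
  by (simp add: Zero_fract_def eq_fract)

lemma const_poly_hom: "unital_ring_hom (\<lambda>c::'a::comm_ring_1. [:c:])"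
  by standard (simp_all add: one_pCons)

lemma unital_ring_hom_comp:
  "unital_ring_hom f \<Longrightarrow> unital_ring_hom g \<Longrightarrow> unital_ring_hom (\<lambda>x. f (g x))"
  by (simp add: unital_ring_hom_def)

lemma rat_const_hom: "unital_ring_hom rat_const"
  unfolding rat_const_def
  by (intro unital_ring_hom_comp[OF to_fract_hom] unital_ring_hom_comp[OF const_poly_hom]
      const_poly_hom)

lemma eval_q_hom: "unital_ring_hom (\<lambda>p. poly (map_poly rat_const p) a)"
  by (rule unital_ring_hom.poly_map_poly_hom[OF rat_const_hom])

lemma eval_qt_hom: "unital_ring_hom (eval_qt a b)"
  unfolding eval_qt_def
  by (rule unital_ring_hom.poly_map_poly_hom[OF eval_q_hom])

section \<open>Monomials in q and t, and evaluation at their inverses\<close>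

lemma qq_neq_0 [simp]: "qq \<noteq> 0"
  by (simp add: qq_def Fract_1_eq_0_iff)

lemma tt_neq_0 [simp]: "tt \<noteq> 0"
  by (simp add: tt_def Fract_1_eq_0_iff)

lemma qq_power_tt_power: "qq ^ a * tt ^ b = Fract (monom (monom 1 a) b) 1"
proof -
  interpret F: unital_ring_hom "\<lambda>P::rat poly poly. Fract P 1" by (rule to_fract_hom)
  interpret C: unital_ring_hom "\<lambda>c::rat poly. [:c:]" by (rule const_poly_hom)
  have "qq ^ a * tt ^ b = Fract ([:[:0, 1:]:] ^ a * [:0, 1:] ^ b) 1"
    unfolding qq_def tt_def by (simp only: F.hom_power F.hom_mult)
  also have "[:[:0, 1:]:] ^ a * [:0, 1:] ^ b = monom (monom 1 a :: rat poly) b"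
    by (simp add: C.hom_power[symmetric] monom_altdef[of _ b] monom_altdef[of _ a])
  finally show ?thesis .
qed

text \<open>A monomial of positive degree in \<open>t\<close> is not the constant 1. This keeps the
  denominators of the Macdonald coefficients nonzero, since their \<open>t\<close>-exponent is an
  arm plus one.\<close>

lemma qq_power_tt_power_neq_1:
  assumes "0 < b" shows "1 - qq ^ a * tt ^ b \<noteq> 0"
proof
  assume "1 - qq ^ a * tt ^ b = 0"
  then have "Fract (monom (monom 1 a) b) 1 = Fract (1 :: rat poly poly) 1"
    by (simp add: qq_power_tt_power One_fract_def[symmetric])
  then have "degree (monom (monom 1 a) b :: rat poly poly) = 0" by (simp only: Fract_1_eq_iff) simp
  then show False using assms by (simp add: degree_monom_eq)
qed

text \<open>Multiplication by \<open>q ^ degree c\<close> turns the exponent \<open>-k\<close> into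
  \<open>degree c - k\<close>, which reverses the list of coefficients.\<close>

lemma eval_q_inverse:
  "poly (map_poly rat_const c) (inverse qq) * qq ^ degree c = Fract [:reflect_poly c:] 1"
proof -
  interpret R: unital_ring_hom rat_const by (rule rat_const_hom)
  interpret F: unital_ring_hom "\<lambda>P::rat poly poly. Fract P 1" by (rule to_fract_hom)
  interpret C: unital_ring_hom "\<lambda>c::rat poly. [:c:]" by (rule const_poly_hom)
  let ?d = "degree c"
  have "poly (map_poly rat_const c) (inverse qq) * qq ^ ?d
      = (\<Sum>k\<le>?d. rat_const (coeff c k) * inverse qq ^ k * qq ^ ?d)"
    by (simp add: R.poly_map_poly_eq[OF order.refl] sum_distrib_right)
  also have "\<dots> = (\<Sum>k\<le>?d. rat_const (coeff c k) * qq ^ (?d - k))"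
  proof (rule sum.cong[OF refl])
    fix k assume "k \<in> {..?d}"
    then have "qq ^ ?d = qq ^ k * qq ^ (?d - k)" by (simp add: power_add[symmetric])
    then show "rat_const (coeff c k) * inverse qq ^ k * qq ^ ?d = rat_const (coeff c k) * qq ^ (?d - k)"
      by (simp add: field_simps)
  qed
  also have "\<dots> = (\<Sum>k\<le>?d. Fract [:monom (coeff c k) (?d - k):] 1)"
  proof (rule sum.cong[OF refl])
    fix k
    have "rat_const (coeff c k) * qq ^ (?d - k) = Fract ([:[:coeff c k:]:] * [:monom 1 (?d - k):]) 1"
      using qq_power_tt_power[of "?d - k" 0]
      by (simp add: rat_const_def monom_0)
    then show "rat_const (coeff c k) * qq ^ (?d - k) = Fract [:monom (coeff c k) (?d - k):] 1"
      by (simp add: smult_monom)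
  qed
  also have "\<dots> = Fract [:\<Sum>k\<le>?d. monom (coeff c k) (?d - k):] 1"
    by (simp only: F.hom_sum C.hom_sum)
  also have "(\<Sum>k\<le>?d. monom (coeff c k) (?d - k)) = reflect_poly c"
  proof (rule poly_eqI)
    fix i
    have "coeff (\<Sum>k\<le>?d. monom (coeff c k) (?d - k)) i = (\<Sum>k\<le>?d. if ?d - k = i then coeff c k else 0)"
      by (simp add: coeff_sum)
    also have "\<dots> = (\<Sum>k\<le>?d. if k = ?d - i \<and> i \<le> ?d then coeff c k else 0)"
      by (intro sum.cong) auto
    also have "\<dots> = coeff (reflect_poly c) i"
      by (auto simp: coeff_reflect_poly)
    finally show "coeff (\<Sum>k\<le>?d. monom (coeff c k) (?d - k)) i = coeff (reflect_poly c) i" .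
  qed
  finally show ?thesis .
qed

text \<open>Multiplying by a large power of \<open>q\<close> and by \<open>t ^ degree P\<close> clears the denominators; the
  constant coefficient of the result comes from the leading coefficient of \<open>P\<close>.\<close>

lemma eval_inverse_neq_0:
  assumes "P \<noteq> 0" shows "eval_qt (inverse qq) (inverse tt) P \<noteq> 0"
proof
  interpret E: unital_ring_hom "\<lambda>p. poly (map_poly rat_const p) (inverse qq)" by (rule eval_q_hom)
  interpret F: unital_ring_hom "\<lambda>P::rat poly poly. Fract P 1" by (rule to_fract_hom)
  let ?N = "degree P"
  define D where "D = (\<Sum>k\<le>?N. degree (coeff P k))"
  have D: "degree (coeff P k) \<le> D" if "k \<le> ?N" for k
    unfolding D_def using that by (intro member_le_sum) auto
  define r where "r k = monom 1 (D - degree (coeff P k)) * reflect_poly (coeff P k)" for k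
  assume "eval_qt (inverse qq) (inverse tt) P = 0"
  then have "0 = qq ^ D * tt ^ ?N * eval_qt (inverse qq) (inverse tt) P" by simp
  also have "\<dots> = (\<Sum>k\<le>?N. poly (map_poly rat_const (coeff P k)) (inverse qq) * inverse tt ^ k
                        * (qq ^ D * tt ^ ?N))"
    unfolding eval_qt_def
    by (subst E.poly_map_poly_eq[OF order.refl]) (simp add: sum_distrib_left mult_ac)
  also have "\<dots> = (\<Sum>k\<le>?N. Fract (monom (r k) (?N - k)) 1)"
  proof (rule sum.cong[OF refl])
    fix k assume k: "k \<in> {..?N}"
    let ?c = "coeff P k"
    have "qq ^ D = qq ^ degree ?c * qq ^ (D - degree ?c)" using D k by (simp add: power_add[symmetric])
    moreover have "tt ^ ?N = tt ^ k * tt ^ (?N - k)" using k by (simp add: power_add[symmetric])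
    ultimately have "poly (map_poly rat_const ?c) (inverse qq) * inverse tt ^ k * (qq ^ D * tt ^ ?N)
        = (poly (map_poly rat_const ?c) (inverse qq) * qq ^ degree ?c) * (qq ^ (D - degree ?c) * tt ^ (?N - k))"
      by (simp add: field_simps)
    also have "\<dots> = Fract ([:reflect_poly ?c:] * monom (monom 1 (D - degree ?c)) (?N - k)) 1"
      by (simp only: eval_q_inverse qq_power_tt_power F.hom_mult)
    also have "[:reflect_poly ?c:] * monom (monom 1 (D - degree ?c)) (?N - k) = monom (r k) (?N - k)"
      by (simp add: r_def smult_monom mult.commute)
    finally show "poly (map_poly rat_const ?c) (inverse qq) * inverse tt ^ k * (qq ^ D * tt ^ ?N)
      = Fract (monom (r k) (?N - k)) 1" .
  qed
  also have "\<dots> = Fract (\<Sum>k\<le>?N. monom (r k) (?N - k)) 1" by (simp only: F.hom_sum)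
  finally have "(\<Sum>k\<le>?N. monom (r k) (?N - k)) = 0" using Fract_1_eq_0_iff by metis
  then have "0 = coeff (\<Sum>k\<le>?N. monom (r k) (?N - k)) 0" by simp
  also have "\<dots> = (\<Sum>k\<le>?N. if k = ?N then r k else 0)"
    unfolding coeff_sum coeff_monom by (intro sum.cong) auto
  also have "\<dots> = r ?N" by simp
  finally show False using assms by (simp add: r_def)
qed

text \<open>Evaluation preserves the cross-multiplied form of an equality of fractions, and
  \<open>eval_inverse_neq_0\<close> allows dividing again. Hence the description in
  \<open>invert_qt\<close> determines one value.\<close>

lemma invert_qt_Fract:
  assumes "Q \<noteq> 0"
  shows "invert_qt (Fract P Q)
    = eval_qt (inverse qq) (inverse tt) P / eval_qt (inverse qq) (inverse tt) Q"
proof -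
  interpret E: unital_ring_hom "eval_qt (inverse qq) (inverse tt)" by (rule eval_qt_hom)
  let ?e = "eval_qt (inverse qq) (inverse tt)"
  have "?e P' / ?e Q' = ?e P / ?e Q" if "Q' \<noteq> 0" "Fract P Q = Fract P' Q'" for P' Q'
  proof -
    have "P * Q' = P' * Q" using that assms by (simp add: eq_fract)
    then have "?e P * ?e Q' = ?e P' * ?e Q" by (metis E.hom_mult)
    then show ?thesis using eval_inverse_neq_0 assms that(1) by (simp add: frac_eq_eq)
  qed
  then show ?thesis unfolding invert_qt_def using assms by (intro the_equality) blast+
qed

lemma invert_qt_hom: "unital_ring_hom invert_qt"
proof -
  interpret E: unital_ring_hom "eval_qt (inverse qq) (inverse tt)" by (rule eval_qt_hom)
  let ?e = "eval_qt (inverse qq) (inverse tt)"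
  show ?thesis
  proof
    show "invert_qt 1 = 1" by (simp add: One_fract_def invert_qt_Fract)
    fix x y :: ratfun
    obtain P Q P' Q' where [simp]: "x = Fract P Q" "Q \<noteq> 0" "y = Fract P' Q'" "Q' \<noteq> 0"
      by (metis Fract_cases)
    have [simp]: "?e Q \<noteq> 0" "?e Q' \<noteq> 0" by (simp_all add: eval_inverse_neq_0)
    show "invert_qt (x * y) = invert_qt x * invert_qt y"
      by (simp add: invert_qt_Fract E.hom_mult)
    show "invert_qt (x + y) = invert_qt x + invert_qt y"
      by (simp add: invert_qt_Fract E.hom_mult E.hom_add add_frac_eq mult.commute)
  qed
qed

lemma invert_qt_qq [simp]: "invert_qt qq = inverse qq"
proof -
  interpret E: unital_ring_hom "eval_qt (inverse qq) (inverse tt)" by (rule eval_qt_hom)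
  have "invert_qt qq = eval_qt (inverse qq) (inverse tt) [:[:0, 1:]:]"
    by (subst qq_def) (simp add: invert_qt_Fract)
  also have "\<dots> = inverse qq"
    by (simp add: eval_qt_def map_poly_pCons unital_ring_hom.hom_zero[OF rat_const_hom]
        unital_ring_hom.hom_one[OF rat_const_hom])
  finally show ?thesis .
qed

lemma invert_qt_tt [simp]: "invert_qt tt = inverse tt"
proof -
  interpret E: unital_ring_hom "eval_qt (inverse qq) (inverse tt)" by (rule eval_qt_hom)
  interpret Q: unital_ring_hom "\<lambda>p. poly (map_poly rat_const p) (inverse qq)" by (rule eval_q_hom)
  have "invert_qt tt = eval_qt (inverse qq) (inverse tt) [:0, 1:]"
    by (subst tt_def) (simp add: invert_qt_Fract)
  also have "\<dots> = inverse tt"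
    using Q.hom_one by (simp add: eval_qt_def map_poly_pCons del: Q.hom_one)
  finally show ?thesis .
qed

lemma invert_qt_inverse: "invert_qt (inverse x) = inverse (invert_qt x)"
proof (cases "x = 0")
  case True
  then show ?thesis using unital_ring_hom.hom_zero[OF invert_qt_hom] by simp
next
  case False
  then have "invert_qt x * invert_qt (inverse x) = 1"
    by (metis invert_qt_hom right_inverse unital_ring_hom.hom_mult unital_ring_hom.hom_one)
  then show ?thesis by (rule inverse_unique[symmetric])
qed

lemma invert_qt_divide: "invert_qt (x / y) = invert_qt x / invert_qt y"
  by (simp add: divide_inverse invert_qt_inverse unital_ring_hom.hom_mult[OF invert_qt_hom])

lemma invert_qt_power_int: "invert_qt (x powi k) = invert_qt x powi k"
  by (simp add: power_int_def invert_qt_inverse unital_ring_hom.hom_power[OF invert_qt_hom])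

section \<open>Demazure--Lusztig operators\<close>

lemma poly_mapping_single_induct:
  fixes f :: "'a \<Rightarrow>\<^sub>0 'b::comm_monoid_add"
  assumes "\<And>k v. P (Poly_Mapping.single k v)"
    and "\<And>f g. P f \<Longrightarrow> P g \<Longrightarrow> P (f + g)"
  shows "P f"
proof (induction f rule: update_induct)
  case const
  then show ?case using assms(1)[of _ 0] by simp
next
  case (update f k v)
  have "Poly_Mapping.update k v f = f + Poly_Mapping.single k v"
    using update(1) by (intro poly_mapping_eqI)
      (auto simp: lookup_update lookup_add lookup_single in_keys_iff when_def)
  then show ?case using assms update by simp
qed

lemma cst_hom: "unital_ring_hom cst"
  by standard (simp_all add: cst_def single_add mult_single)

interpretation cst: unital_ring_hom cst by (rule cst_hom)

definition monom_at :: "(nat \<Rightarrow> mpol) \<Rightarrow> (nat \<Rightarrow>\<^sub>0 nat) \<Rightarrow> mpol" where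
  "monom_at s e = (\<Prod>i\<in>Poly_Mapping.keys e. s i ^ Poly_Mapping.lookup e i)"

lemma monom_at_superset:
  assumes "finite A" "Poly_Mapping.keys e \<subseteq> A"
  shows "monom_at s e = (\<Prod>i\<in>A. s i ^ Poly_Mapping.lookup e i)"
  unfolding monom_at_def using assms
  by (intro prod.mono_neutral_left) (auto simp: in_keys_iff)

lemma monom_at_add: "monom_at s (e + e') = monom_at s e * monom_at s e'"
proof -
  let ?A = "Poly_Mapping.keys e \<union> Poly_Mapping.keys e'"
  have "Poly_Mapping.keys (e + e') \<subseteq> ?A" by (rule keys_add)
  then show ?thesis
    by (simp add: monom_at_superset[of ?A] lookup_add power_add prod.distrib)
qed

lemma monom_at_single: "monom_at s (Poly_Mapping.single i k) = s i ^ k"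
  by (subst monom_at_superset[of "{i}"]) simp_all

lemma monom_at_zero [simp]: "monom_at s 0 = 1"
  by (simp add: monom_at_def)

lemma monom_at_xvar: "monom_at xvar e = Poly_Mapping.single e 1"
proof (induction e rule: poly_mapping_single_induct)
  case (1 i k)
  have "xvar i ^ k = Poly_Mapping.single (Poly_Mapping.single i k) 1"
    by (induction k) (simp_all add: xvar_def mult_single single_add[symmetric])
  then show ?case by (simp add: monom_at_single)
next
  case (2 e e')
  then show ?case by (simp add: monom_at_add mult_single)
qed

text \<open>Constants and variables generate the polynomial ring, so any property stable under sums
  and products can be checked on them alone.\<close>

lemma mpol_induct [case_names cst xvar add mult]:
  assumes cst: "\<And>c. P (cst c)" and xvar: "\<And>i. P (xvar i)"
    and add: "\<And>f g. P f \<Longrightarrow> P g \<Longrightarrow> P (f + g)" and mult: "\<And>f g. P f \<Longrightarrow> P g \<Longrightarrow> P (f * g)"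
  shows "P f"
proof (induction f rule: poly_mapping_single_induct)
  case (1 e c)
  have pow: "P (xvar i ^ k)" for i k
    using cst[of 1] by (induction k) (simp_all add: xvar mult)
  have "P (\<Prod>i\<in>A. xvar i ^ Poly_Mapping.lookup e i)" for A
    using cst[of 1] by (induction A rule: infinite_finite_induct) (simp_all add: mult pow)
  then have "P (cst c * monom_at xvar e)" by (simp add: monom_at_def mult cst)
  then show ?case by (simp add: monom_at_xvar cst_def mult_single)
qed (rule add)

context
  fixes \<phi> :: "ratfun \<Rightarrow> ratfun" and s :: "nat \<Rightarrow> mpol"
  assumes \<phi>: "unital_ring_hom \<phi>"
begin

interpretation \<phi>: unital_ring_hom \<phi> by (rule \<phi>)

lemma subst_poly_superset:
  assumes "finite A" "Poly_Mapping.keys f \<subseteq> A"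
  shows "subst_poly \<phi> s f = (\<Sum>e\<in>A. cst (\<phi> (Poly_Mapping.lookup f e)) * monom_at s e)"
  unfolding subst_poly_def monom_at_def using assms
  by (intro sum.mono_neutral_left) (auto simp: in_keys_iff)

lemma subst_poly_single:
  "subst_poly \<phi> s (Poly_Mapping.single e c) = cst (\<phi> c) * monom_at s e"
  by (subst subst_poly_superset[of "{e}"]) simp_all

lemma subst_poly_add: "subst_poly \<phi> s (f + g) = subst_poly \<phi> s f + subst_poly \<phi> s g"
proof -
  let ?A = "Poly_Mapping.keys f \<union> Poly_Mapping.keys g"
  have "Poly_Mapping.keys (f + g) \<subseteq> ?A" by (rule keys_add)
  then show ?thesis
    by (simp add: subst_poly_superset[of ?A] lookup_add \<phi>.hom_add cst.hom_add sum.distrib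
        distrib_right)
qed

lemma subst_poly_mult: "subst_poly \<phi> s (f * g) = subst_poly \<phi> s f * subst_poly \<phi> s g"
proof (induction f rule: poly_mapping_single_induct)
  case (1 e c)
  show ?case
  proof (induction g rule: poly_mapping_single_induct)
    case (1 e' c')
    then show ?case
      by (simp add: mult_single subst_poly_single \<phi>.hom_mult cst.hom_mult monom_at_add mult_ac)
  next
    case (2 g g')
    then show ?case by (simp add: distrib_left subst_poly_add)
  qed
next
  case (2 f f')
  then show ?case by (simp add: distrib_right subst_poly_add)
qed

lemma subst_poly_cst [simp]: "subst_poly \<phi> s (cst c) = cst (\<phi> c)"
  using subst_poly_single[of 0 c] by (simp add: cst_def)

lemma subst_poly_xvar [simp]: "subst_poly \<phi> s (xvar i) = s i"
  by (simp add: xvar_def subst_poly_single monom_at_single)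

lemma subst_poly_hom: "unital_ring_hom (subst_poly \<phi> s)"
proof
  show "subst_poly \<phi> s 1 = 1" using subst_poly_cst[of 1] by simp
qed (simp_all add: subst_poly_add subst_poly_mult)

end

lemma identity_hom: "unital_ring_hom (\<lambda>c. c)"
  by standard simp_all

lemma perm_act_cst [simp]: "perm_act \<pi> (cst c) = cst c"
  by (simp add: perm_act_def subst_poly_cst[OF identity_hom])

lemma perm_act_xvar [simp]: "perm_act \<pi> (xvar i) = xvar (\<pi> i)"
  by (simp add: perm_act_def subst_poly_xvar[OF identity_hom])

lemma perm_act_hom: "unital_ring_hom (perm_act \<pi>)"
  unfolding perm_act_def[abs_def] by (rule subst_poly_hom[OF identity_hom])

interpretation perm_act: unital_ring_hom "perm_act \<pi>" for \<pi> by (rule perm_act_hom)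

lemma perm_act_transpose_involutory: "perm_act (transpose a b) (perm_act (transpose a b) f) = f"
  by (induction f rule: mpol_induct) (simp_all add: perm_act.hom_add perm_act.hom_mult)

lemma xvar_eq_iff [simp]: "xvar i = xvar j \<longleftrightarrow> i = j"
  by (metis keys_single one_neq_zero singleton_inject xvar_def)

lemma xvar_diff_neq_0: "xvar i - xvar (Suc i) \<noteq> 0"
  by simp

lemma divided_diff_exists: "\<exists>g. g * (xvar i - xvar (Suc i)) = perm_act (transpose i (Suc i)) f - f"
proof (induction f rule: mpol_induct)
  case (cst c)
  show ?case by (rule exI[of _ 0]) simp
next
  case (xvar j)
  consider "j = i" | "j = Suc i" | "j \<noteq> i" "j \<noteq> Suc i" by blast
  then show ?case
  proof cases
    case 1 then show ?thesis by (intro exI[of _ "-1"]) simp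
  next
    case 2 then show ?thesis by (intro exI[of _ 1]) simp
  next
    case 3 then show ?thesis by (intro exI[of _ 0]) simp
  qed
next
  case (add f g)
  then obtain f' g' where "f' * (xvar i - xvar (Suc i)) = perm_act (transpose i (Suc i)) f - f"
    "g' * (xvar i - xvar (Suc i)) = perm_act (transpose i (Suc i)) g - g" by blast
  then show ?case
    by (intro exI[of _ "f' + g'"]) (simp add: distrib_right perm_act.hom_add)
next
  case (mult f g)
  let ?s = "perm_act (transpose i (Suc i))" and ?D = "xvar i - xvar (Suc i)"
  obtain f' g' where fg: "f' * ?D = ?s f - f" "g' * ?D = ?s g - g" using mult by blast
  \<comment> \<open>This is the twisted Leibniz rule: the quotient for \<open>f * g\<close> is
    \<open>?s f\<close> times the quotient for \<open>g\<close>, plus the quotient for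
    \<open>f\<close> times \<open>g\<close>.\<close>
  have "(?s f * g' + f' * g) * ?D = ?s f * (g' * ?D) + (f' * ?D) * g" by (simp add: algebra_simps)
  also have "\<dots> = ?s (f * g) - f * g" unfolding fg by (simp add: algebra_simps perm_act.hom_mult)
  finally show ?case by blast
qed

lemma divided_diff_mult: "divided_diff i f * (xvar i - xvar (Suc i)) = perm_act (transpose i (Suc i)) f - f"
proof -
  let ?s = "perm_act (transpose i (Suc i))" and ?D = "xvar i - xvar (Suc i)"
  have "\<exists>!g. g * ?D = ?s f - f"
    using divided_diff_exists[of i f] mult_right_cancel[OF xvar_diff_neq_0[of i]] by metis
  then show ?thesis unfolding divided_diff_def by (rule theI')
qed

text \<open>Multiplying by \<open>xvar i - xvar (Suc i)\<close> removes the division. Cancelling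
  this factor shows that the equation characterises the operator, so later rules reduce to
  polynomial identities in \<open>f\<close> and its image under the transposition.\<close>

lemma demazure_lusztig_cleared:
  "(xvar i - xvar (Suc i)) * demazure_lusztig i f
    = (cst tt * xvar i - xvar (Suc i)) * perm_act (transpose i (Suc i)) f
      - (cst tt - 1) * xvar (Suc i) * f"
proof -
  let ?s = "perm_act (transpose i (Suc i))" and ?D = "xvar i - xvar (Suc i)"
  have "?D * demazure_lusztig i f
      = cst tt * ?D * ?s f + (cst tt - 1) * xvar (Suc i) * (divided_diff i f * ?D)"
    by (simp add: demazure_lusztig_def cst.hom_diff algebra_simps)
  then show ?thesis unfolding divided_diff_mult by (simp add: algebra_simps)
qed

lemma demazure_lusztig_unique:
  assumes "(xvar i - xvar (Suc i)) * g
    = (cst tt * xvar i - xvar (Suc i)) * perm_act (transpose i (Suc i)) f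
      - (cst tt - 1) * xvar (Suc i) * f"
  shows "demazure_lusztig i f = g"
  using assms mult_left_cancel[OF xvar_diff_neq_0[of i]] by (metis demazure_lusztig_cleared)

section \<open>Hecke algebra rules for the operators\<close>

lemma demazure_lusztig_add:
  "demazure_lusztig i (f + g) = demazure_lusztig i f + demazure_lusztig i g"
  by (rule demazure_lusztig_unique)
    (simp add: distrib_left demazure_lusztig_cleared perm_act.hom_add; simp add: algebra_simps)

lemma demazure_lusztig_mult_symmetric:
  assumes "perm_act (transpose i (Suc i)) f = f"
  shows "demazure_lusztig i (f * g) = f * demazure_lusztig i g"
  by (rule demazure_lusztig_unique)
    (simp add: mult.left_commute[of _ f] demazure_lusztig_cleared perm_act.hom_mult assms;
     simp add: algebra_simps)

lemma demazure_lusztig_cst_mult: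
  "demazure_lusztig i (cst c * f) = cst c * demazure_lusztig i f"
  by (rule demazure_lusztig_mult_symmetric) simp

lemma demazure_lusztig_zero [simp]: "demazure_lusztig i 0 = 0"
  using demazure_lusztig_cst_mult[of i 0 0] by simp

lemma demazure_lusztig_sum:
  "demazure_lusztig i (sum f A) = (\<Sum>a\<in>A. demazure_lusztig i (f a))"
  by (induction A rule: infinite_finite_induct) (simp_all add: demazure_lusztig_add)

lemma demazure_lusztig_one: "demazure_lusztig i 1 = cst tt"
  by (rule demazure_lusztig_unique) (simp add: algebra_simps)

lemma demazure_lusztig_xvar_mult:
  assumes "k \<noteq> i" "k \<noteq> Suc i"
  shows "demazure_lusztig i (xvar k * f) = xvar k * demazure_lusztig i f"
  by (rule demazure_lusztig_mult_symmetric) (use assms in simp)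

text \<open>By the quadratic relation below, T_i - (t - 1) is t times the inverse of T_i. The rule
  is thus the affine Hecke relation T_i x_i = t x_{i+1} T_i^{-1}.\<close>

lemma demazure_lusztig_xvar_mult_left:
  "demazure_lusztig i (xvar i * f) = xvar (Suc i) * (demazure_lusztig i f - (cst tt - 1) * f)"
proof (rule demazure_lusztig_unique)
  let ?D = "xvar i - xvar (Suc i)"
  have "?D * (xvar (Suc i) * (demazure_lusztig i f - (cst tt - 1) * f))
      = xvar (Suc i) * (?D * demazure_lusztig i f) - xvar (Suc i) * ?D * (cst tt - 1) * f"
    by (simp add: algebra_simps)
  then show "?D * (xvar (Suc i) * (demazure_lusztig i f - (cst tt - 1) * f))
      = (cst tt * xvar i - xvar (Suc i)) * perm_act (transpose i (Suc i)) (xvar i * f)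
        - (cst tt - 1) * xvar (Suc i) * (xvar i * f)"
    unfolding demazure_lusztig_cleared by (simp add: perm_act.hom_mult algebra_simps)
qed

lemma demazure_lusztig_xvar_mult_right:
  "demazure_lusztig i (xvar (Suc i) * f)
    = xvar i * demazure_lusztig i f + (cst tt - 1) * xvar (Suc i) * f"
proof (rule demazure_lusztig_unique)
  let ?D = "xvar i - xvar (Suc i)"
  have "?D * (xvar i * demazure_lusztig i f + (cst tt - 1) * xvar (Suc i) * f)
      = xvar i * (?D * demazure_lusztig i f) + ?D * (cst tt - 1) * xvar (Suc i) * f"
    by (simp add: algebra_simps)
  then show "?D * (xvar i * demazure_lusztig i f + (cst tt - 1) * xvar (Suc i) * f)
      = (cst tt * xvar i - xvar (Suc i)) * perm_act (transpose i (Suc i)) (xvar (Suc i) * f)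
        - (cst tt - 1) * xvar (Suc i) * (xvar (Suc i) * f)"
    unfolding demazure_lusztig_cleared by (simp add: perm_act.hom_mult algebra_simps)
qed

text \<open>The Hecke relation (T_i - t)(T_i + 1) = 0.\<close>

lemma demazure_lusztig_quadratic:
  "demazure_lusztig i (demazure_lusztig i f) = (cst tt - 1) * demazure_lusztig i f + cst tt * f"
proof (rule demazure_lusztig_unique)
  let ?D = "xvar i - xvar (Suc i)" and ?s = "perm_act (transpose i (Suc i))"
    and ?T = "demazure_lusztig i f"
  \<comment> \<open>Applying the transposition to the cleared formula yields its action on
    \<open>?T\<close>. The verification then multiplies by \<open>?D\<close> twice, once for each
    application of the operator, and finally cancels one factor.\<close>
  have "?s (?D * ?T) = ?s ((cst tt * xvar i - xvar (Suc i)) * ?s f - (cst tt - 1) * xvar (Suc i) * f)"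
    by (simp only: demazure_lusztig_cleared)
  then have "(xvar (Suc i) - xvar i) * ?s ?T
      = (cst tt * xvar (Suc i) - xvar i) * f - (cst tt - 1) * xvar i * ?s f"
    by (simp add: perm_act.hom_mult perm_act.hom_diff perm_act_transpose_involutory)
  then have s: "?D * ?s ?T = (cst tt - 1) * xvar i * ?s f - (cst tt * xvar (Suc i) - xvar i) * f"
    by (simp add: algebra_simps)
  have "?D * (?D * ((cst tt - 1) * ?T + cst tt * f))
      = (cst tt - 1) * ?D * (?D * ?T) + ?D * ?D * cst tt * f"
    by (simp add: algebra_simps)
  also have "\<dots> = (cst tt * xvar i - xvar (Suc i)) * (?D * ?s ?T)
      - (cst tt - 1) * xvar (Suc i) * (?D * ?T)"
    unfolding s demazure_lusztig_cleared by (simp add: algebra_simps)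
  finally have "?D * (?D * ((cst tt - 1) * ?T + cst tt * f))
      = ?D * ((cst tt * xvar i - xvar (Suc i)) * ?s ?T - (cst tt - 1) * xvar (Suc i) * ?T)"
    by (simp add: algebra_simps)
  then show "?D * ((cst tt - 1) * ?T + cst tt * f)
      = (cst tt * xvar i - xvar (Suc i)) * ?s ?T - (cst tt - 1) * xvar (Suc i) * ?T"
    using mult_left_cancel[OF xvar_diff_neq_0[of i]] by blast
qed

text \<open>The hypothesis says that the inverse of T_i sends \<open>f\<close> to \<open>g\<close>
  divided by \<open>c\<close>, and multiplication by \<open>xvar i\<close> brings in exactly this
  inverse. In the induction on states this trades a new box with value \<open>i\<close> for one with
  value \<open>i + 1\<close>.\<close>

lemma demazure_lusztig_xvar_mult_partner:
  assumes "demazure_lusztig i g = cst c * f" "c \<noteq> 0"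
  shows "demazure_lusztig i (xvar i * f) = cst (tt / c) * (xvar (Suc i) * g)"
proof -
  have "cst c * demazure_lusztig i f = demazure_lusztig i (demazure_lusztig i g)"
    by (simp add: assms(1) demazure_lusztig_cst_mult)
  also have "\<dots> = cst c * ((cst tt - 1) * f) + cst tt * g"
    by (subst demazure_lusztig_quadratic) (simp add: assms(1) mult_ac)
  finally have "cst c * (demazure_lusztig i f - (cst tt - 1) * f) = cst tt * g"
    by (simp add: algebra_simps)
  then have "cst (1 / c) * cst c * (demazure_lusztig i f - (cst tt - 1) * f) = cst (1 / c) * cst tt * g"
    by (simp only: mult.assoc)
  then have "demazure_lusztig i f - (cst tt - 1) * f = cst (tt / c) * g"
    using assms(2) by (simp add: cst.hom_mult[symmetric])
  then show ?thesis
    unfolding demazure_lusztig_xvar_mult_left by (simp only: mult.left_commute)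
qed

section \<open>A recursion for the permuted-basement polynomials\<close>

text \<open>For \<open>w \<notin> {x, y}\<close> this is \<open>1\<close> if \<open>x, w, y\<close> are distinct and in increasing cyclic order, and \<open>0\<close>
  otherwise.\<close>

definition cyc :: "nat \<Rightarrow> nat \<Rightarrow> nat \<Rightarrow> int" where
  "cyc x w y = 1 + of_bool (y < x) - of_bool (w < x) - of_bool (y < w)"

text \<open>A state lists the columns of the frontier, the next column to grow first, as pairs of the
  topmost value and the number of boxes still to be added.\<close>

type_synonym state = "(nat \<times> nat) list"

definition cyc_sum :: "nat \<Rightarrow> nat \<Rightarrow> nat \<Rightarrow> state \<Rightarrow> int" where
  "cyc_sum x b h r = (\<Sum>(v, k)\<leftarrow>r. if k < h then cyc x v b else 0)"

definition num_lower :: "nat \<Rightarrow> state \<Rightarrow> nat" where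
  "num_lower h r = length (filter (\<lambda>(v, k). k < h) r)"

text \<open>Here \<open>h\<close> counts the box being placed, so it is the leg plus one. For a
  column of the frontier, \<open>k < h\<close> says precisely that it contributes to the arm, so
  \<open>num_lower h r\<close> is the arm.\<close>

definition step_weight :: "nat \<Rightarrow> nat \<Rightarrow> nat \<Rightarrow> state \<Rightarrow> ratfun" where
  "step_weight x b h r = (if b < x then qq ^ h else 1) * tt powi cyc_sum x b h r *
     (if x = b then 1 else (1 - tt) / (1 - qq ^ h * tt ^ (num_lower h r + 1)))"

text \<open>A new value may repeat \<open>b\<close>, the value directly below, but must avoid the
  rest of the frontier. A finished column is dropped when it comes to the front, because no later
  box attacks its top.\<close>

function gen_fun :: "nat \<Rightarrow> state \<Rightarrow> mpol" where
  "gen_fun n [] = 1"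
| "gen_fun n ((b, 0) # r) = gen_fun n r"
| "gen_fun n ((b, Suc h) # r) = (\<Sum>x\<in>{1..n} - fst ` set r.
     cst (step_weight x b (Suc h) r) * (xvar x * gen_fun n (r @ [(x, h)])))"
  by pat_completeness auto
termination
  \<comment> \<open>Each column counts one more than its height, so that dropping a finished column
    also decreases the measure.\<close>
  by (relation "measure (\<lambda>(n, w). \<Sum>(b, h)\<leftarrow>w. Suc h)") auto

lemma cyc_sum_append [simp]: "cyc_sum x b h (r @ r') = cyc_sum x b h r + cyc_sum x b h r'"
  by (simp add: cyc_sum_def)

lemma cyc_sum_Cons [simp]:
  "cyc_sum x b h ((v, k) # r) = (if k < h then cyc x v b else 0) + cyc_sum x b h r"
  by (simp add: cyc_sum_def)

lemma num_lower_append [simp]: "num_lower h (r @ r') = num_lower h r + num_lower h r'"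
  by (simp add: num_lower_def)

lemma num_lower_Cons [simp]: "num_lower h ((v, k) # r) = of_bool (k < h) + num_lower h r"
  by (simp add: num_lower_def)

lemma cyc_sum_cong:
  assumes "\<And>v. v \<in> fst ` set r \<Longrightarrow> cyc x v b = cyc x' v b'"
  shows "cyc_sum x b h r = cyc_sum x' b' h r"
proof -
  have "map (\<lambda>(v, k). if k < h then cyc x v b else 0) r = map (\<lambda>(v, k). if k < h then cyc x' v b' else 0) r"
    using assms by (force intro!: map_cong)
  then show ?thesis unfolding cyc_sum_def by (rule arg_cong)
qed

lemma cyc_sum_const:
  assumes "\<And>v. v \<in> fst ` set r \<Longrightarrow> cyc x v b = c"
  shows "cyc_sum x b h r = c * int (num_lower h r)"
  using assms
proof (induction r)
  case Nil
  then show ?case by (simp add: cyc_sum_def num_lower_def)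
next
  case (Cons p r)
  then show ?case by (cases p) (auto simp: algebra_simps)
qed

section \<open>Box weights under the exchange of i and i + 1\<close>

definition avoids :: "nat \<Rightarrow> state \<Rightarrow> bool" where
  "avoids i r \<longleftrightarrow> i \<notin> fst ` set r \<and> Suc i \<notin> fst ` set r"

lemma avoids_simps [simp]:
  "avoids i []"
  "avoids i ((v, k) # r) \<longleftrightarrow> v \<noteq> i \<and> v \<noteq> Suc i \<and> avoids i r"
  "avoids i (r @ r') \<longleftrightarrow> avoids i r \<and> avoids i r'"
  by (auto simp: avoids_def)

text \<open>Every other value compares in the same way with \<open>i\<close> and with
  \<open>i + 1\<close>, so each of the three positions may be shifted from one to the other.\<close>

lemma cyc_Suc_middle: "x \<notin> {i, Suc i} \<Longrightarrow> y \<notin> {i, Suc i} \<Longrightarrow> cyc x i y = cyc x (Suc i) y"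
  by (auto simp: cyc_def)

lemma cyc_Suc_left: "w \<notin> {i, Suc i} \<Longrightarrow> y \<notin> {i, Suc i} \<Longrightarrow> cyc i w y = cyc (Suc i) w y"
  by (auto simp: cyc_def)

lemma cyc_Suc_right: "x \<notin> {i, Suc i} \<Longrightarrow> w \<notin> {i, Suc i} \<Longrightarrow> cyc x w i = cyc x w (Suc i)"
  by (auto simp: cyc_def)

lemma cyc_sum_Suc_left:
  assumes "avoids i r" "b \<notin> {i, Suc i}"
  shows "cyc_sum i b h r = cyc_sum (Suc i) b h r"
  using assms unfolding avoids_def by (intro cyc_sum_cong cyc_Suc_left) blast+

lemma cyc_sum_Suc_right:
  assumes "avoids i r" "x \<notin> {i, Suc i}"
  shows "cyc_sum x i h r = cyc_sum x (Suc i) h r"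
  using assms unfolding avoids_def by (intro cyc_sum_cong cyc_Suc_right) blast+

lemma step_weight_same: "x \<notin> fst ` set r \<Longrightarrow> step_weight x x h r = 1"
  using cyc_sum_const[of r x x 0 h] by (force simp: step_weight_def cyc_def)

lemma step_weight_Suc_middle:
  assumes "x \<notin> {i, Suc i}" "b \<notin> {i, Suc i}"
  shows "step_weight x b h (u @ (i, a) # v) = step_weight x b h (u @ (Suc i, a) # v)"
  unfolding step_weight_def cyc_sum_append cyc_sum_Cons num_lower_append num_lower_Cons
    cyc_Suc_middle[OF assms] by (rule refl)

lemma step_weight_Suc_left:
  assumes "avoids i r" "b \<notin> {i, Suc i}"
  shows "step_weight i b h r = step_weight (Suc i) b h r"
proof -
  have "b < i \<longleftrightarrow> b < Suc i" "i \<noteq> b" "Suc i \<noteq> b" using assms by auto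
  then show ?thesis by (simp add: step_weight_def cyc_sum_Suc_left[OF assms])
qed

lemma step_weight_Suc_right:
  assumes "avoids i r" "x \<notin> {i, Suc i}"
  shows "step_weight x i h r = step_weight x (Suc i) h r"
proof -
  have "i < x \<longleftrightarrow> Suc i < x" "x \<noteq> i" "x \<noteq> Suc i" using assms by auto
  then show ?thesis by (simp add: step_weight_def cyc_sum_Suc_right[OF assms])
qed

text \<open>Only the column carrying the other of the two values changes its orientation:
  \<open>cyc\<close> is 1 for the triple \<open>i, i + 1, b\<close> and 0 for
  \<open>i + 1, i, b\<close>. It matters only if that column belongs to the arm.\<close>

lemma step_weight_swap_left:
  assumes "avoids i u" "avoids i v" "b \<notin> {i, Suc i}"
  shows "step_weight i b h (u @ (Suc i, a) # v)
    = tt powi of_bool (a < h) * step_weight (Suc i) b h (u @ (i, a) # v)"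
proof -
  have "cyc_sum i b h u = cyc_sum (Suc i) b h u" "cyc_sum i b h v = cyc_sum (Suc i) b h v"
    using assms by (auto intro!: cyc_sum_Suc_left)
  moreover have "cyc i (Suc i) b = 1" "cyc (Suc i) i b = 0" using assms by (auto simp: cyc_def)
  moreover have "b < i \<longleftrightarrow> b < Suc i" "i \<noteq> b" "Suc i \<noteq> b" using assms by auto
  ultimately show ?thesis by (simp add: step_weight_def power_int_add)
qed

lemma step_weight_swap_right:
  assumes "avoids i u" "avoids i v" "x \<notin> {i, Suc i}"
  shows "step_weight x (Suc i) h (u @ (i, a) # v)
    = tt powi of_bool (a < h) * step_weight x i h (u @ (Suc i, a) # v)"
proof -
  have "cyc_sum x i h u = cyc_sum x (Suc i) h u" "cyc_sum x i h v = cyc_sum x (Suc i) h v"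
    using assms by (auto intro!: cyc_sum_Suc_right)
  moreover have "cyc x (Suc i) i = 0" "cyc x i (Suc i) = 1" using assms by (auto simp: cyc_def)
  moreover have "i < x \<longleftrightarrow> Suc i < x" "x \<noteq> i" "x \<noteq> Suc i" using assms by auto
  ultimately show ?thesis by (simp add: step_weight_def power_int_add)
qed

text \<open>No other value separates \<open>i\<close> from \<open>i + 1\<close>, so every
  \<open>cyc\<close> term is 0 here; in the descent below every term is 1, which gives the full
  power of \<open>t\<close>.\<close>

lemma step_weight_ascent:
  assumes "avoids i r"
  shows "step_weight i (Suc i) h r = (1 - tt) / (1 - qq ^ h * tt ^ (num_lower h r + 1))"
  using assms cyc_sum_const[of r i "Suc i" 0 h]
  by (force simp: step_weight_def cyc_def avoids_def)

lemma step_weight_descent: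
  assumes "avoids i r"
  shows "step_weight (Suc i) i h r
    = qq ^ h * tt ^ num_lower h r * ((1 - tt) / (1 - qq ^ h * tt ^ (num_lower h r + 1)))"
proof -
  have "cyc_sum (Suc i) i h r = 1 * int (num_lower h r)"
    using assms by (intro cyc_sum_const) (auto simp: cyc_def avoids_def not_less_eq)
  then show ?thesis by (simp add: step_weight_def)
qed

text \<open>With \<open>?Q\<close> the monomial in the denominator, (1 - t)/(1 - Q) - (1 - t) = Q (1
  - t)/(1 - Q). This absorbs the term with factor t - 1 that the operator creates when
  \<open>i + 1\<close> is placed on top of \<open>i + 1\<close>.\<close>

lemma step_weight_ascent_descent:
  assumes "avoids i r"
  shows "step_weight i (Suc i) h r + tt - 1 = tt * step_weight (Suc i) i h r"
proof -
  let ?Q = "qq ^ h * tt ^ (num_lower h r + 1)"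
  have "1 - ?Q \<noteq> 0" by (rule qq_power_tt_power_neq_1) simp
  then have "(1 - tt) / (1 - ?Q) + tt - 1 = ?Q * ((1 - tt) / (1 - ?Q))"
    by (simp add: divide_simps) (simp add: algebra_simps)
  then show ?thesis
    unfolding step_weight_ascent[OF assms] step_weight_descent[OF assms] by (simp add: mult_ac)
qed

section \<open>Demazure--Lusztig operators on the generating functions\<close>

definition state_size :: "state \<Rightarrow> nat" where
  "state_size w = (\<Sum>(b, h)\<leftarrow>w. Suc h)"

lemma state_size_simps [simp]:
  "state_size [] = 0"
  "state_size ((b, h) # w) = Suc h + state_size w"
  "state_size (w @ w') = state_size w + state_size w'"
  by (simp_all add: state_size_def)

definition other_values :: "nat \<Rightarrow> nat \<Rightarrow> state \<Rightarrow> nat set" where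
  "other_values n i r = {1..n} - fst ` set r - {i, Suc i}"

lemma finite_other_values [simp]: "finite (other_values n i r)"
  by (simp add: other_values_def)

context
  fixes n i :: nat
  assumes i: "i \<in> {1..<n}"
begin

lemma sum_split_none:
  fixes F :: "nat \<Rightarrow> mpol"
  assumes "avoids i r"
  shows "(\<Sum>x\<in>{1..n} - fst ` set r. F x) = F i + F (Suc i) + (\<Sum>x\<in>other_values n i r. F x)"
proof -
  have "{1..n} - fst ` set r = insert i (insert (Suc i) (other_values n i r))"
    using i assms unfolding other_values_def avoids_def by auto
  moreover have "i \<notin> other_values n i r" "Suc i \<notin> other_values n i r"
    by (auto simp: other_values_def)
  ultimately show ?thesis by (simp add: add.assoc)
qed

lemma sum_split_left:
  fixes F :: "nat \<Rightarrow> mpol"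
  assumes "avoids i u" "avoids i v"
  shows "(\<Sum>x\<in>{1..n} - fst ` set (u @ (i, a) # v). F x)
    = F (Suc i) + (\<Sum>x\<in>other_values n i (u @ v). F x)"
proof -
  have "{1..n} - fst ` set (u @ (i, a) # v) = insert (Suc i) (other_values n i (u @ v))"
    using i assms unfolding other_values_def avoids_def by auto
  moreover have "Suc i \<notin> other_values n i (u @ v)"
    by (auto simp: other_values_def)
  ultimately show ?thesis by simp
qed

lemma sum_split_right:
  fixes F :: "nat \<Rightarrow> mpol"
  assumes "avoids i u" "avoids i v"
  shows "(\<Sum>x\<in>{1..n} - fst ` set (u @ (Suc i, a) # v). F x)
    = F i + (\<Sum>x\<in>other_values n i (u @ v). F x)"
proof -
  have "{1..n} - fst ` set (u @ (Suc i, a) # v) = insert i (other_values n i (u @ v))"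
    using i assms unfolding other_values_def avoids_def by auto
  moreover have "i \<notin> other_values n i (u @ v)"
    by (auto simp: other_values_def)
  ultimately show ?thesis by simp
qed

lemma values_both:
  "{1..n} - fst ` set (u @ (i, a) # v @ (Suc i, c) # w) = other_values n i (u @ v @ w)"
  "{1..n} - fst ` set (u @ (Suc i, a) # v @ (i, c) # w) = other_values n i (u @ v @ w)"
  by (auto simp: other_values_def)

text \<open>The three conjuncts have to be proved simultaneously, by induction on the number of steps of
  the recursion: placing \<open>i\<close> or \<open>i + 1\<close> on top of a column leads from one case to another.\<close>

lemma demazure_lusztig_gen_fun_induct:
  "(\<forall>w. state_size w < k \<longrightarrow> avoids i w \<longrightarrow>
      demazure_lusztig i (gen_fun n w) = cst tt * gen_fun n w) \<and>
   (\<forall>u a v. state_size (u @ (i, a) # v) < k \<longrightarrow> avoids i u \<longrightarrow> avoids i v \<longrightarrow>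
      demazure_lusztig i (gen_fun n (u @ (Suc i, a) # v)) = cst tt * gen_fun n (u @ (i, a) # v)) \<and>
   (\<forall>u a v c w. state_size (u @ (i, a) # v @ (Suc i, c) # w) < k \<longrightarrow>
      avoids i u \<longrightarrow> avoids i v \<longrightarrow> avoids i w \<longrightarrow>
      demazure_lusztig i (gen_fun n (u @ (i, a) # v @ (Suc i, c) # w))
        = cst (tt powi of_bool (a \<le> c)) * gen_fun n (u @ (Suc i, a) # v @ (i, c) # w))"
proof (induction k)
  case 0
  show ?case by simp
next
  case (Suc k)
  let ?T = "demazure_lusztig i" and ?G = "gen_fun n"
  have none: "?T (?G w) = cst tt * ?G w" if "state_size w < k" "avoids i w" for w
    using Suc that by blast
  have one: "?T (?G (u @ (Suc i, a) # v)) = cst tt * ?G (u @ (i, a) # v)"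
    if "state_size (u @ (i, a) # v) < k" "avoids i u" "avoids i v" for u a v
    using Suc that by blast
  have both: "?T (?G (u @ (i, a) # v @ (Suc i, c) # w))
      = cst (tt powi of_bool (a \<le> c)) * ?G (u @ (Suc i, a) # v @ (i, c) # w)"
    if "state_size (u @ (i, a) # v @ (Suc i, c) # w) < k" "avoids i u" "avoids i v" "avoids i w"
    for u a v c w
    using Suc that by blast
  have other: "?T (cst c * (xvar x * ?G w)) = cst c * (xvar x * ?T (?G w))"
    if "x \<in> other_values n i r" for c x r w
    using that by (simp add: other_values_def demazure_lusztig_cst_mult demazure_lusztig_xvar_mult)

  have NONE: "?T (?G w) = cst tt * ?G w" if k: "state_size w < Suc k" and w: "avoids i w" for w
  proof (cases w)
    case Nil
    then show ?thesis by (simp add: demazure_lusztig_one)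
  next
    case (Cons p r)
    obtain b h where p: "p = (b, h)" by (cases p)
    show ?thesis
    proof (cases h)
      case 0
      then show ?thesis using k w by (simp add: Cons p none)
    next
      case (Suc h')
      let ?F = "\<lambda>x. cst (step_weight x b (Suc h') r) * (xvar x * ?G (r @ [(x, h')]))"
      have r: "avoids i r" and b: "b \<notin> {i, Suc i}" using w by (auto simp: Cons p)
      have G: "?G w = ?F i + ?F (Suc i) + sum ?F (other_values n i r)"
        unfolding Cons p Suc gen_fun.simps sum_split_none[OF r] ..
      have IH: "?T (?G (r @ [(Suc i, h')])) = cst tt * ?G (r @ [(i, h')])"
        using one[of r h' "[]"] k r by (simp add: Cons p Suc)
      \<comment> \<open>The two terms are handled together: the first is sent to the second, and the
        second to t times the first plus t - 1 times itself, so the sum is multiplied by t.\<close>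
      have "?T (?F i + ?F (Suc i)) = cst tt * (?F i + ?F (Suc i))"
        using demazure_lusztig_xvar_mult_partner[OF IH]
        by (simp add: demazure_lusztig_add demazure_lusztig_cst_mult step_weight_Suc_left[OF r b]
            demazure_lusztig_xvar_mult_right IH; simp add: algebra_simps)
      moreover have "?T (sum ?F (other_values n i r)) = cst tt * sum ?F (other_values n i r)"
        unfolding demazure_lusztig_sum sum_distrib_left
      proof (rule sum.cong[OF refl])
        fix x assume x: "x \<in> other_values n i r"
        have "?T (?G (r @ [(x, h')])) = cst tt * ?G (r @ [(x, h')])"
          using k r x by (intro none) (auto simp: Cons p Suc other_values_def)
        then show "?T (?F x) = cst tt * ?F x" using x by (simp add: other; simp add: mult_ac)
      qed
      ultimately show ?thesis
        unfolding G by (subst demazure_lusztig_add) (simp add: distrib_left)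
    qed
  qed

  have ONE: "?T (?G (u @ (Suc i, a) # v)) = cst tt * ?G (u @ (i, a) # v)"
    if k: "state_size (u @ (i, a) # v) < Suc k" and u: "avoids i u" and v: "avoids i v" for u a v
  proof (cases u)
    case Nil
    show ?thesis
    proof (cases a)
      case 0
      then show ?thesis using k v by (simp add: Nil none)
    next
      case (Suc h)
      let ?F = "\<lambda>b x. cst (step_weight x b (Suc h) v) * (xvar x * ?G (v @ [(x, h)]))"
      let ?c = "step_weight i (Suc i) (Suc h) v" and ?d = "step_weight (Suc i) i (Suc h) v"
      have G: "?G (u @ (b, a) # v) = ?F b i + ?F b (Suc i) + sum (?F b) (other_values n i v)" for b
        unfolding Nil Suc append_Nil gen_fun.simps sum_split_none[OF v] ..
      have IH: "?T (?G (v @ [(Suc i, h)])) = cst tt * ?G (v @ [(i, h)])"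
        using one[of v h "[]"] k v by (simp add: Nil Suc)
      have same: "step_weight x x (Suc h) v = 1" if "x \<in> {i, Suc i}" for x
        using that v by (auto simp: avoids_def intro: step_weight_same)
      \<comment> \<open>The term with \<open>x = i\<close> contributes \<open>?c\<close> times the
        polynomial for \<open>Suc i\<close>, and the term with \<open>x = Suc i\<close> contributes
        t - 1 times the same polynomial. Their total coefficient is t times the weight
        \<open>?d\<close> of a descent from \<open>i\<close>.\<close>
      have "?T (?F (Suc i) i + ?F (Suc i) (Suc i))
          = cst tt * (xvar i * ?G (v @ [(i, h)]))
            + (cst ?c + (cst tt - 1)) * (xvar (Suc i) * ?G (v @ [(Suc i, h)]))"
        using demazure_lusztig_xvar_mult_partner[OF IH]
        by (simp add: demazure_lusztig_add demazure_lusztig_cst_mult same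
            demazure_lusztig_xvar_mult_right IH; simp add: algebra_simps)
      also have "cst ?c + (cst tt - 1) = cst tt * cst ?d"
        using arg_cong[OF step_weight_ascent_descent[OF v, of "Suc h"], of cst]
        by (simp add: cst.hom_add cst.hom_diff cst.hom_mult add_diff_eq)
      finally have "?T (?F (Suc i) i + ?F (Suc i) (Suc i)) = cst tt * (?F i i + ?F i (Suc i))"
        by (simp add: same distrib_left mult_ac)
      moreover have "?T (sum (?F (Suc i)) (other_values n i v)) = cst tt * sum (?F i) (other_values n i v)"
        unfolding demazure_lusztig_sum sum_distrib_left
      proof (rule sum.cong[OF refl])
        fix x assume x: "x \<in> other_values n i v"
        have "?T (?G (v @ [(x, h)])) = cst tt * ?G (v @ [(x, h)])"
          using k v x by (intro none) (auto simp: Nil Suc other_values_def)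
        moreover have "step_weight x i (Suc h) v = step_weight x (Suc i) (Suc h) v"
          using v x by (intro step_weight_Suc_right) (auto simp: other_values_def)
        ultimately show "?T (?F (Suc i) x) = cst tt * ?F i x" using x by (simp add: other; simp add: mult_ac)
      qed
      ultimately show ?thesis
        unfolding G by (subst demazure_lusztig_add) (simp add: distrib_left)
    qed
  next
    case (Cons p u')
    obtain b h where p: "p = (b, h)" by (cases p)
    have u': "avoids i u'" and b: "b \<notin> {i, Suc i}" using u by (auto simp: Cons p)
    show ?thesis
    proof (cases h)
      case 0
      then show ?thesis using k u' v by (simp add: Cons p one)
    next
      case (Suc h')
      let ?r = "\<lambda>y. u' @ (y, a) # v"
      let ?F = "\<lambda>y x. cst (step_weight x b (Suc h') (?r y)) * (xvar x * ?G (?r y @ [(x, h')]))"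
      let ?S = "other_values n i (u' @ v)"
      have GL: "?G (u @ (i, a) # v) = ?F i (Suc i) + sum (?F i) ?S"
        unfolding Cons p Suc append_Cons gen_fun.simps sum_split_left[OF u' v] ..
      have GR: "?G (u @ (Suc i, a) # v) = ?F (Suc i) i + sum (?F (Suc i)) ?S"
        unfolding Cons p Suc append_Cons gen_fun.simps sum_split_right[OF u' v] ..
      have IH: "?T (?G (?r i @ [(Suc i, h')])) = cst (tt powi of_bool (a \<le> h')) * ?G (?r (Suc i) @ [(i, h')])"
        using both[of u' a v h' "[]"] k u' v by (simp add: Cons p Suc)
      have "?T (?F (Suc i) i) = cst (step_weight i b (Suc h') (?r (Suc i)) * (tt / tt powi of_bool (a \<le> h')))
          * (xvar (Suc i) * ?G (?r i @ [(Suc i, h')]))"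
        using demazure_lusztig_xvar_mult_partner[OF IH]
        by (simp add: demazure_lusztig_cst_mult cst.hom_mult)
      \<comment> \<open>Here \<open>i\<close> comes after \<open>i + 1\<close>, so the induction
        hypothesis was used through the inverse operator. Its exponent condition
        \<open>a \<le> h'\<close> is the arm condition \<open>a < Suc h'\<close>, and the power of t
        from the weight cancels the denominator.\<close>
      also have "step_weight i b (Suc h') (?r (Suc i)) * (tt / tt powi of_bool (a \<le> h'))
          = tt * step_weight (Suc i) b (Suc h') (?r i)"
        by (simp add: step_weight_swap_left[OF u' v b] less_Suc_eq_le)
      finally have "?T (?F (Suc i) i) = cst tt * ?F i (Suc i)" by (simp add: cst.hom_mult mult_ac)
      moreover have "?T (sum (?F (Suc i)) ?S) = cst tt * sum (?F i) ?S"
        unfolding demazure_lusztig_sum sum_distrib_left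
      proof (rule sum.cong[OF refl])
        fix x assume x: "x \<in> ?S"
        have "?T (?G (?r (Suc i) @ [(x, h')])) = cst tt * ?G (?r i @ [(x, h')])"
          using one[of u' a "v @ [(x, h')]"] k u' v x by (simp add: Cons p Suc other_values_def)
        moreover have "step_weight x b (Suc h') (?r i) = step_weight x b (Suc h') (?r (Suc i))"
          using b x by (intro step_weight_Suc_middle) (auto simp: other_values_def)
        ultimately show "?T (?F (Suc i) x) = cst tt * ?F i x" using x by (simp add: other; simp add: mult_ac)
      qed
      ultimately show ?thesis
        unfolding GL GR by (subst demazure_lusztig_add) (simp add: distrib_left)
    qed
  qed

  have BOTH: "?T (?G (u @ (i, a) # v @ (Suc i, c) # w))
      = cst (tt powi of_bool (a \<le> c)) * ?G (u @ (Suc i, a) # v @ (i, c) # w)"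
    if k: "state_size (u @ (i, a) # v @ (Suc i, c) # w) < Suc k"
      and u: "avoids i u" and v: "avoids i v" and w: "avoids i w" for u a v c w
  proof (cases u)
    case Nil
    show ?thesis
    proof (cases a)
      case 0
      \<comment> \<open>The column with value \<open>i\<close> is finished and leaves, so the case
        of a single value applies; its factor t agrees with the exponent because 0 \<le>
        \<open>c\<close>.\<close>
      then show ?thesis using k v w by (simp add: Nil one)
    next
      case (Suc h)
      let ?r = "\<lambda>y. v @ (y, c) # w"
      let ?F = "\<lambda>b y x. cst (step_weight x b (Suc h) (?r y)) * (xvar x * ?G (?r y @ [(x, h)]))"
      let ?S = "other_values n i (v @ w)" and ?e = "tt powi of_bool (a \<le> c)"
      have GL: "?G (u @ (i, a) # v @ (Suc i, c) # w) = ?F i (Suc i) i + sum (?F i (Suc i)) ?S"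
        unfolding Nil Suc append_Nil gen_fun.simps sum_split_right[OF v w] ..
      have GR: "?G (u @ (Suc i, a) # v @ (i, c) # w) = ?F (Suc i) i (Suc i) + sum (?F (Suc i) i) ?S"
        unfolding Nil Suc append_Nil gen_fun.simps sum_split_left[OF v w] ..
      \<comment> \<open>Since \<open>a = Suc h\<close>, exactly one of \<open>c \<le> h\<close> and
        \<open>a \<le> c\<close> holds.\<close>
      have e: "tt / tt powi of_bool (c \<le> h) = ?e"
        by (auto simp: Suc)
      have IH: "?T (?G (?r i @ [(Suc i, h)])) = cst (tt powi of_bool (c \<le> h)) * ?G (?r (Suc i) @ [(i, h)])"
        using both[of v c w h "[]"] k v w by (simp add: Nil Suc)
      have "step_weight i i (Suc h) (?r (Suc i)) = 1" "step_weight (Suc i) (Suc i) (Suc h) (?r i) = 1"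
        using v w by (simp_all add: step_weight_same avoids_def image_Un)
      moreover have "?T (xvar i * ?G (?r (Suc i) @ [(i, h)]))
          = cst ?e * (xvar (Suc i) * ?G (?r i @ [(Suc i, h)]))"
        by (rule demazure_lusztig_xvar_mult_partner[OF IH, unfolded e]) simp
      ultimately have "?T (?F i (Suc i) i) = cst ?e * ?F (Suc i) i (Suc i)"
        by (simp only: cst.hom_one mult_1)
      moreover have "?T (sum (?F i (Suc i)) ?S) = cst ?e * sum (?F (Suc i) i) ?S"
        unfolding demazure_lusztig_sum sum_distrib_left
      proof (rule sum.cong[OF refl])
        fix x assume x: "x \<in> ?S"
        have IH: "?T (?G (?r (Suc i) @ [(x, h)])) = cst tt * ?G (?r i @ [(x, h)])"
          using one[of v c "w @ [(x, h)]"] k v w x by (simp add: Nil Suc other_values_def)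
        have "x \<notin> {i, Suc i}" using x by (auto simp: other_values_def)
        then have "tt * step_weight x i (Suc h) (?r (Suc i)) = ?e * step_weight x (Suc i) (Suc h) (?r i)"
          using step_weight_swap_right[OF v w, of x "Suc h" c] by (simp add: Suc not_less_eq_eq)
        then have wt: "cst tt * cst (step_weight x i (Suc h) (?r (Suc i)))
            = cst ?e * cst (step_weight x (Suc i) (Suc h) (?r i))"
          by (metis cst.hom_mult)
        have "?T (?F i (Suc i) x)
            = (cst tt * cst (step_weight x i (Suc h) (?r (Suc i)))) * (xvar x * ?G (?r i @ [(x, h)]))"
          unfolding other[OF x] IH by (simp only: mult_ac)
        then show "?T (?F i (Suc i) x) = cst ?e * ?F (Suc i) i x"
          unfolding wt by (simp only: mult.assoc)
      qed
      ultimately show ?thesis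
        unfolding GL GR by (subst demazure_lusztig_add) (simp add: distrib_left)
    qed
  next
    case (Cons p u')
    obtain b h where p: "p = (b, h)" by (cases p)
    have u': "avoids i u'" and b: "b \<notin> {i, Suc i}" using u by (auto simp: Cons p)
    show ?thesis
    proof (cases h)
      case 0
      then show ?thesis using k u' v w by (simp add: Cons p both)
    next
      case (Suc h')
      let ?r = "\<lambda>y z. u' @ (y, a) # v @ (z, c) # w" and ?e = "tt powi of_bool (a \<le> c)"
      let ?F = "\<lambda>y z x. cst (step_weight x b (Suc h') (?r y z)) * (xvar x * ?G (?r y z @ [(x, h')]))"
      let ?S = "other_values n i (u' @ v @ w)"
      have GL: "?G (u @ (i, a) # v @ (Suc i, c) # w) = sum (?F i (Suc i)) ?S"
        unfolding Cons p Suc append_Cons gen_fun.simps values_both ..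
      have GR: "?G (u @ (Suc i, a) # v @ (i, c) # w) = sum (?F (Suc i) i) ?S"
        unfolding Cons p Suc append_Cons gen_fun.simps values_both ..
      show ?thesis unfolding GL GR demazure_lusztig_sum sum_distrib_left
      proof (rule sum.cong[OF refl])
        fix x assume x: "x \<in> ?S"
        have IH: "?T (?G (?r i (Suc i) @ [(x, h')])) = cst ?e * ?G (?r (Suc i) i @ [(x, h')])"
          using both[of u' a v c "w @ [(x, h')]"] k u' v w x by (simp add: Cons p Suc other_values_def)
        have x': "x \<notin> {i, Suc i}" using x by (auto simp: other_values_def)
        have "step_weight x b (Suc h') (?r i (Suc i)) = step_weight x b (Suc h') (?r (Suc i) (Suc i))"
          by (rule step_weight_Suc_middle[OF x' b])
        also have "\<dots> = step_weight x b (Suc h') (?r (Suc i) i)"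
          using step_weight_Suc_middle[OF x' b, of _ "u' @ (Suc i, a) # v"] by simp
        finally show "?T (?F i (Suc i) x) = cst ?e * ?F (Suc i) i x"
          unfolding other[OF x] IH by (simp add: mult_ac)
      qed
    qed
  qed
  show ?case using NONE ONE BOTH by blast
qed

lemma demazure_lusztig_gen_fun:
  assumes "avoids i u" "avoids i v" "avoids i w"
  shows "demazure_lusztig i (gen_fun n (u @ (i, a) # v @ (Suc i, c) # w))
    = cst (tt powi of_bool (a \<le> c)) * gen_fun n (u @ (Suc i, a) # v @ (i, c) # w)"
  using demazure_lusztig_gen_fun_induct assms by blast

end

section \<open>Reduced words\<close>

definition initial_state :: "nat \<Rightarrow> (nat \<Rightarrow> nat) \<Rightarrow> (nat \<Rightarrow> nat) \<Rightarrow> state" where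
  "initial_state n \<pi> \<mu> = map (\<lambda>k. (\<pi> k, \<mu> k)) [1..<Suc n]"

lemma demazure_lusztig_initial_state:
  assumes i: "i \<in> {1..<n}" and \<pi>: "\<pi> permutes {1..n}"
    and pq: "1 \<le> p" "p < q" "q \<le> n" "\<pi> p = i" "\<pi> q = Suc i"
  shows "demazure_lusztig i (gen_fun n (initial_state n \<pi> \<mu>))
    = cst (tt powi of_bool (\<mu> p \<le> \<mu> q)) *
      gen_fun n (initial_state n (transpose i (Suc i) \<circ> \<pi>) \<mu>)"
proof -
  let ?f = "\<lambda>\<rho> k. (\<rho> k, \<mu> k)"
  let ?u = "map (?f \<pi>) [1..<p]" and ?v = "map (?f \<pi>) [Suc p..<q]" and ?w = "map (?f \<pi>) [Suc q..<Suc n]"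
  have split: "[1..<Suc n] = [1..<p] @ p # [Suc p..<q] @ q # [Suc q..<Suc n]"
    using pq upt_add_eq_append[of 1 p "Suc n - p"] upt_add_eq_append[of "Suc p" q "Suc n - q"]
    by (simp add: upt_conv_Cons del: upt_Suc)
  have ne: "\<pi> k \<noteq> i" "\<pi> k \<noteq> Suc i" if "k \<noteq> p" "k \<noteq> q" for k
    using that permutes_inj[OF \<pi>] pq by (metis injD)+
  have av: "avoids i ?u" "avoids i ?v" "avoids i ?w"
    using ne pq by (auto simp: avoids_def image_image simp del: upt_Suc dest: sym)
  have same: "transpose i (Suc i) (\<pi> k) = \<pi> k" if "k \<noteq> p" "k \<noteq> q" for k
    using ne[OF that] by simp
  have 1: "initial_state n \<pi> \<mu> = ?u @ (i, \<mu> p) # ?v @ (Suc i, \<mu> q) # ?w"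
    unfolding initial_state_def split using pq by simp
  have 2: "initial_state n (transpose i (Suc i) \<circ> \<pi>) \<mu> = ?u @ (Suc i, \<mu> p) # ?v @ (i, \<mu> q) # ?w"
    unfolding initial_state_def split using pq by (simp add: same del: upt_Suc)
  show ?thesis unfolding 1 2 by (rule demazure_lusztig_gen_fun[OF i av])
qed

text \<open>Exchanging two consecutive values alters no comparison except the one at positions
  \<open>p\<close> and \<open>q\<close>. The increment is the exponent of t in
  \<open>demazure_lusztig_initial_state\<close>.\<close>

lemma ell_transpose:
  assumes \<pi>: "\<pi> permutes {1..n}"
    and pq: "1 \<le> p" "p < q" "q \<le> n" "\<pi> p = i" "\<pi> q = Suc i"
  shows "ell n \<mu> (transpose i (Suc i) \<circ> \<pi>) = ell n \<mu> \<pi> + of_bool (\<mu> p \<le> \<mu> q)"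
proof -
  define S where "S \<rho> = {(a, b). 1 \<le> a \<and> a < b \<and> b \<le> n \<and> \<rho> a > \<rho> b \<and> \<mu> a \<le> \<mu> b}" for \<rho> :: "nat \<Rightarrow> nat"
  have fin: "finite (S \<rho>)" for \<rho>
    by (rule finite_subset[of _ "{1..n} \<times> {1..n}"]) (auto simp: S_def)
  have ne: "\<pi> k = i \<longleftrightarrow> k = p" "\<pi> k = Suc i \<longleftrightarrow> k = q" for k
    using permutes_inj[OF \<pi>] pq by (metis injD)+
  have cmp: "transpose i (Suc i) x > transpose i (Suc i) y \<longleftrightarrow>
      (x > y \<and> \<not> (x = Suc i \<and> y = i)) \<or> (x = i \<and> y = Suc i)" for x y
    by (auto simp: transpose_def)
  have "S (transpose i (Suc i) \<circ> \<pi>) = S \<pi> \<union> (if \<mu> p \<le> \<mu> q then {(p, q)} else {})"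
    unfolding S_def o_apply cmp ne using pq by auto
  moreover have "(p, q) \<notin> S \<pi>" using pq by (simp add: S_def)
  ultimately have "card (S (transpose i (Suc i) \<circ> \<pi>)) = card (S \<pi>) + of_bool (\<mu> p \<le> \<mu> q)"
    using fin by simp
  then show ?thesis by (simp add: ell_def S_def)
qed

text \<open>For the zero composition the condition on heights always holds, and \<open>ell\<close>
  becomes the Coxeter length.\<close>

abbreviation num_inversions :: "nat \<Rightarrow> (nat \<Rightarrow> nat) \<Rightarrow> nat" where
  "num_inversions n \<equiv> ell n (\<lambda>_. 0)"

lemma ell_id [simp]: "ell n \<mu> id = 0"
proof -
  have "{(i, j). 1 \<le> i \<and> i < j \<and> j \<le> n \<and> id i > id j \<and> \<mu> i \<le> \<mu> j} = {}" by auto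
  then show ?thesis unfolding ell_def by (simp only: card.empty)
qed

section \<open>Words in the simple transpositions and their lengths\<close>

lemma word_perm_Nil [simp]: "word_perm [] = id"
  by (simp add: word_perm_def)

lemma word_perm_Cons:
  fixes i :: nat and w :: "nat list"
  shows "word_perm (i # w) = transpose i (Suc i) \<circ> word_perm w"
  by (simp add: word_perm_def)

lemma transpose_permutes: "i \<in> {1..<n} \<Longrightarrow> transpose i (Suc i) permutes {1..n}"
  by (intro permutes_swap_id) auto

lemma word_perm_permutes: "set w \<subseteq> {1..<n} \<Longrightarrow> word_perm w permutes {1..n}"
proof (induction w)
  case (Cons i w)
  then show ?case
    unfolding word_perm_Cons by (intro permutes_compose transpose_permutes) auto
qed (simp add: permutes_id)

text \<open>After left multiplication \<open>i\<close> precedes \<open>i + 1\<close>, so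
  \<open>ell_transpose\<close> applies to the product; the transposition is an involution.\<close>

lemma num_inversions_descent:
  assumes \<pi>: "\<pi> permutes {1..n}" and i: "i \<in> {1..<n}"
    and pq: "1 \<le> q" "q < p" "p \<le> n" "\<pi> p = i" "\<pi> q = Suc i"
  shows "num_inversions n \<pi> = Suc (num_inversions n (transpose i (Suc i) \<circ> \<pi>))"
proof -
  have "num_inversions n (transpose i (Suc i) \<circ> (transpose i (Suc i) \<circ> \<pi>))
      = num_inversions n (transpose i (Suc i) \<circ> \<pi>) + of_bool True"
    by (subst ell_transpose[of _ n q p])
      (use assms permutes_compose[OF \<pi> transpose_permutes[OF i]] in simp_all)
  then show ?thesis by (simp flip: o_assoc) (simp add: o_assoc)
qed

lemma permutes_positions:
  assumes "\<pi> permutes {1..n}" "i \<in> {1..<n}"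
  obtains p q where "p \<in> {1..n}" "q \<in> {1..n}" "p \<noteq> q" "\<pi> p = i" "\<pi> q = Suc i"
proof -
  have "i \<in> \<pi> ` {1..n}" "Suc i \<in> \<pi> ` {1..n}"
    using assms by (auto simp: permutes_image)
  then show ?thesis using that by (metis imageE n_not_Suc_n)
qed

lemma num_inversions_le_length:
  "set w \<subseteq> {1..<n} \<Longrightarrow> num_inversions n (word_perm w) \<le> length w"
proof (induction w)
  case (Cons i w)
  have i: "i \<in> {1..<n}" and \<pi>: "word_perm w permutes {1..n}"
    using Cons.prems word_perm_permutes by auto
  have IH: "num_inversions n (word_perm w) \<le> length w" using Cons by simp
  obtain p q where pq: "p \<in> {1..n}" "q \<in> {1..n}" "p \<noteq> q" "word_perm w p = i" "word_perm w q = Suc i"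
    using permutes_positions[OF \<pi> i] .
  show ?case
  proof (cases "p < q")
    case True
    then show ?thesis using ell_transpose[OF \<pi> _ True, of i "\<lambda>_. 0"] pq IH
      unfolding word_perm_Cons by (simp add: o_def)
  next
    case False
    then have "q < p" using pq by simp
    then show ?thesis using num_inversions_descent[OF \<pi> i _ \<open>q < p\<close>] pq IH
      unfolding word_perm_Cons by (simp add: o_def)
  qed
qed simp

text \<open>Bubble sort on values: as long as some \<open>i + 1\<close> stands to the left of
  \<open>i\<close>, exchanging them removes one inversion and costs one letter.\<close>

lemma word_of_length_num_inversions:
  assumes "\<pi> permutes {1..n}"
  shows "\<exists>w. set w \<subseteq> {1..<n} \<and> word_perm w = \<pi> \<and> length w = num_inversions n \<pi>"
  using assms
proof (induction "num_inversions n \<pi>" arbitrary: \<pi> rule: less_induct)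
  case (less \<pi>)
  let ?g = "inv \<pi>"
  have g: "?g permutes {1..n}" by (rule permutes_inv[OF less.prems])
  have \<pi>g: "\<pi> (?g k) = k" for k by (simp add: permutes_inverses[OF less.prems])
  have gin: "?g k \<in> {1..n} \<longleftrightarrow> k \<in> {1..n}" for k by (rule permutes_in_image[OF g])
  show ?case
  proof (cases "\<exists>i\<in>{1..<n}. ?g (Suc i) < ?g i")
    case True
    then obtain i where i: "i \<in> {1..<n}" "?g (Suc i) < ?g i" by blast
    let ?\<rho> = "transpose i (Suc i) \<circ> \<pi>"
    have inv: "num_inversions n \<pi> = Suc (num_inversions n ?\<rho>)"
      using i gin[of i] gin[of "Suc i"] by (intro num_inversions_descent[OF less.prems]) (auto simp: \<pi>g)
    have "?\<rho> permutes {1..n}" by (rule permutes_compose[OF less.prems transpose_permutes[OF i(1)]])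
    then obtain w where w: "set w \<subseteq> {1..<n}" "word_perm w = ?\<rho>" "length w = num_inversions n ?\<rho>"
      using less.hyps[of ?\<rho>] inv by auto
    have "word_perm (i # w) = \<pi>" using w(2) by (simp add: word_perm_Cons o_assoc)
    then show ?thesis using w i inv by (intro exI[of _ "i # w"]) simp
  next
    case False
    have lt: "?g i < ?g (Suc i)" if "i \<in> {1..<n}" for i
    proof -
      have "?g i \<noteq> ?g (Suc i)" using \<pi>g by (metis n_not_Suc_n)
      then show ?thesis using False that by force
    qed
    \<comment> \<open>Without such an \<open>i\<close> the inverse is strictly increasing on {1..n},
      hence lies above the identity, and a permutation with this property is the identity.\<close>
    have "k \<le> ?g k" if "k \<in> {1..n}" for k
      using that
    proof (induction k)
      case (Suc k)
      show ?case
      proof (cases "k = 0")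
        case True
        then show ?thesis using gin[of "Suc k"] Suc.prems by auto
      next
        case False
        then show ?thesis using lt[of k] Suc by simp
      qed
    qed simp
    then have "?g = id" by (intro permutes_natset_ge[OF g]) auto
    then have "\<pi> = id" using \<pi>g by auto
    then show ?thesis by (intro exI[of _ "[]"]) simp
  qed
qed

lemma reduced_word_exists:
  assumes "\<pi> permutes {1..n}" shows "\<exists>w. reduced_word n \<pi> w"
  using word_of_length_num_inversions[OF assms] num_inversions_le_length
  unfolding reduced_word_def by metis

lemma reduced_word_length:
  assumes "\<pi> permutes {1..n}" "reduced_word n \<pi> w"
  shows "length w = num_inversions n \<pi>"
  using word_of_length_num_inversions[OF assms(1)] assms(2) num_inversions_le_length
  unfolding reduced_word_def by (metis order_antisym)

text \<open>Length equal to the inversion number passes to every final segment of the word. So each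
  letter meets a state in which \<open>i\<close> precedes \<open>i + 1\<close>, and the exponents of
  t accumulate exactly as \<open>ell\<close> does.\<close>

lemma foldr_demazure_lusztig:
  assumes "set w \<subseteq> {1..<n}" "length w = num_inversions n (word_perm w)"
  shows "foldr demazure_lusztig w (gen_fun n (initial_state n id \<mu>))
    = cst (tt powi int (ell n \<mu> (word_perm w))) * gen_fun n (initial_state n (word_perm w) \<mu>)"
  using assms
proof (induction w)
  case (Cons i w)
  let ?\<pi> = "word_perm w"
  have i: "i \<in> {1..<n}" and w: "set w \<subseteq> {1..<n}" using Cons.prems by auto
  have \<pi>: "?\<pi> permutes {1..n}" by (rule word_perm_permutes[OF w])
  have le: "num_inversions n ?\<pi> \<le> length w" by (rule num_inversions_le_length[OF w])
  obtain p q where pq: "p \<in> {1..n}" "q \<in> {1..n}" "p \<noteq> q" "?\<pi> p = i" "?\<pi> q = Suc i"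
    using permutes_positions[OF \<pi> i] .
  \<comment> \<open>Otherwise the letter \<open>i\<close> would lower the inversion number, and the
    word would be longer than the inversion number of its product.\<close>
  have "\<not> q < p"
    using num_inversions_descent[OF \<pi> i, of q p] pq le Cons.prems(2)
    unfolding word_perm_Cons by (auto simp: o_def)
  then have "p < q" using pq by simp
  with pq have pq': "1 \<le> p" "p < q" "q \<le> n" "?\<pi> p = i" "?\<pi> q = Suc i" by auto
  have "length w = num_inversions n ?\<pi>"
    using ell_transpose[OF \<pi> pq', of "\<lambda>_. 0"] Cons.prems(2) unfolding word_perm_Cons by (simp add: o_def)
  note IH = Cons.IH[OF w this]
  have "foldr demazure_lusztig (i # w) (gen_fun n (initial_state n id \<mu>))
      = demazure_lusztig i (foldr demazure_lusztig w (gen_fun n (initial_state n id \<mu>)))"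
    by (simp only: foldr_Cons o_apply)
  also have "\<dots> = cst (tt powi int (ell n \<mu> ?\<pi>)) * (cst (tt powi of_bool (\<mu> p \<le> \<mu> q)) *
      gen_fun n (initial_state n (transpose i (Suc i) \<circ> ?\<pi>) \<mu>))"
    unfolding IH demazure_lusztig_cst_mult demazure_lusztig_initial_state[OF i \<pi> pq'] ..
  also have "\<dots> = cst (tt powi int (ell n \<mu> (transpose i (Suc i) \<circ> ?\<pi>))) *
      gen_fun n (initial_state n (transpose i (Suc i) \<circ> ?\<pi>) \<mu>)"
    unfolding ell_transpose[OF \<pi> pq']
    by (simp add: mult.assoc[symmetric] cst.hom_mult[symmetric] power_int_add)
  finally show ?case unfolding word_perm_Cons .
qed simp

lemma demazure_lusztig_perm_initial_state:
  assumes "\<pi> permutes {1..n}"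
  shows "demazure_lusztig_perm n \<pi> (gen_fun n (initial_state n id \<mu>))
    = cst (tt powi int (ell n \<mu> \<pi>)) * gen_fun n (initial_state n \<pi> \<mu>)"
proof -
  let ?w = "SOME w. reduced_word n \<pi> w"
  have w: "reduced_word n \<pi> ?w" by (rule someI_ex[OF reduced_word_exists[OF assms]])
  then have "set ?w \<subseteq> {1..<n}" "word_perm ?w = \<pi>" "length ?w = num_inversions n \<pi>"
    using reduced_word_length[OF assms w] by (auto simp: reduced_word_def)
  then show ?thesis using foldr_demazure_lusztig[of ?w n \<mu>] by (simp add: demazure_lusztig_perm_def)
qed

section \<open>Block complements\<close>

text \<open>Complements act on values, so both complemented blocks arise from one map applied after
  the permutation. This lets the recursion transport states value by value.\<close>

definition block_compl :: "nat \<Rightarrow> nat \<Rightarrow> nat \<Rightarrow> nat" where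
  "block_compl m n x = (if x \<le> m then m + 1 - x else n + m + 1 - x)"

text \<open>The boxes still to be added over values of the upper block. For the initial state this
  is the exponent \<open>p\<close> of the theorem, because the permutation preserves the
  blocks.\<close>

definition upper_height :: "nat \<Rightarrow> state \<Rightarrow> nat" where
  "upper_height m w = (\<Sum>(b, h)\<leftarrow>w. if m < b then h else 0)"

lemma upper_height_simps [simp]:
  "upper_height m [] = 0"
  "upper_height m ((b, h) # w) = (if m < b then h else 0) + upper_height m w"
  "upper_height m (w @ w') = upper_height m w + upper_height m w'"
  by (simp_all add: upper_height_def)

lemma num_lower_map_apfst [simp]: "num_lower h (map (apfst f) r) = num_lower h r"
  by (simp add: num_lower_def filter_map comp_def case_prod_unfold)

lemma cyc_sum_map_apfst:
  "cyc_sum x b h (map (apfst f) r) = (\<Sum>(v, k)\<leftarrow>r. if k < h then cyc x (f v) b else 0)"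
  by (simp add: cyc_sum_def comp_def case_prod_unfold cong: if_cong)

abbreviation block_subst :: "nat \<Rightarrow> nat \<Rightarrow> mpol \<Rightarrow> mpol" where
  "block_subst m n \<equiv> subst_poly invert_qt
     (\<lambda>i. if i \<le> m then xvar (m + 1 - i) else cst qq * xvar (n + m + 1 - i))"

context
  fixes m n :: nat
  assumes mn: "m \<le> n"
begin

lemma block_compl_in: "x \<in> {1..n} \<Longrightarrow> block_compl m n x \<in> {1..n}"
  using mn by (auto simp: block_compl_def)

lemma block_compl_involutory: "x \<in> {1..n} \<Longrightarrow> block_compl m n (block_compl m n x) = x"
  using mn by (auto simp: block_compl_def)

lemma block_compl_inj: "inj_on (block_compl m n) {1..n}"
  by (metis block_compl_involutory inj_on_inverseI)

lemma block_compl_image: "block_compl m n ` {1..n} = {1..n}"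
  using block_compl_in block_compl_involutory by (metis imageI subsetI subset_antisym image_subsetI)

text \<open>Comparisons reverse inside a block and persist between blocks. The block indicators
  enter as a difference, so they cancel around a triple and survive only in the exponent of
  q.\<close>

lemma block_compl_less:
  assumes "x \<in> {1..n}" "y \<in> {1..n}" "x \<noteq> y"
  shows "of_bool (block_compl m n x < block_compl m n y)
    = 1 - of_bool (x < y) + of_bool (m < y) - (of_bool (m < x) :: int)"
  using assms by (auto simp: block_compl_def)

text \<open>As a map of \<open>\<int>/n\<close> the block complement is a reflection, so it reverses cyclic orientations.\<close>

lemma cyc_block_compl:
  assumes "x \<in> {1..n}" "w \<in> {1..n}" "y \<in> {1..n}" "x \<noteq> w" "w \<noteq> y" "x \<noteq> y"
  shows "cyc (block_compl m n x) (block_compl m n w) (block_compl m n y) = 1 - cyc x w y"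
  unfolding cyc_def using assms block_compl_less[of y x] block_compl_less[of w x] block_compl_less[of y w]
  by simp

lemma cyc_sum_block_compl:
  assumes "x \<in> {1..n}" "b \<in> {1..n}" "x \<noteq> b" "fst ` set r \<subseteq> {1..n}"
    "x \<notin> fst ` set r" "b \<notin> fst ` set r"
  shows "cyc_sum (block_compl m n x) (block_compl m n b) h (map (apfst (block_compl m n)) r)
    = int (num_lower h r) - cyc_sum x b h r"
  using assms(4-6) unfolding cyc_sum_map_apfst
proof (induction r)
  case Nil
  then show ?case by (simp add: cyc_sum_def num_lower_def)
next
  case (Cons p r)
  obtain v k where p: "p = (v, k)" by (cases p)
  have "cyc (block_compl m n x) (block_compl m n v) (block_compl m n b) = 1 - cyc x v b"
    using Cons.prems assms(1-3) by (intro cyc_block_compl) (auto simp: p)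
  then show ?case using Cons by (simp add: p)
qed

text \<open>Inverting q and t in the fraction multiplies it by \<open>q ^ h * t ^ arm\<close>. The
  power of t complements the count of coinversion triples, and the power of q exchanges descents and
  ascents up to the block indicators.\<close>

lemma step_weight_block_compl:
  assumes "x \<in> {1..n}" "b \<in> {1..n}" "fst ` set r \<subseteq> {1..n}"
    "x \<notin> fst ` set r" "b \<notin> fst ` set r"
  shows "step_weight (block_compl m n x) (block_compl m n b) h (map (apfst (block_compl m n)) r)
    = invert_qt (step_weight x b h r) * qq powi (int h * (of_bool (m < x) - of_bool (m < b)))"
proof (cases "x = b")
  case True
  have "block_compl m n b \<notin> fst ` set (map (apfst (block_compl m n)) r)"
  proof
    assume "block_compl m n b \<in> fst ` set (map (apfst (block_compl m n)) r)"
    then obtain v where "v \<in> fst ` set r" "block_compl m n b = block_compl m n v" by force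
    then show False using inj_onD[OF block_compl_inj] assms by blast
  qed
  then show ?thesis
    using True assms by (simp add: step_weight_same unital_ring_hom.hom_one[OF invert_qt_hom])
next
  case False
  interpret I: unital_ring_hom invert_qt by (rule invert_qt_hom)
  let ?c = "block_compl m n" and ?A = "num_lower h r" and ?C = "cyc_sum x b h r"
  let ?Q = "qq ^ h * tt ^ (?A + 1)"
  let ?K = "(1 - tt) / (1 - ?Q)"
  have ne: "?c x \<noteq> ?c b" using False assms inj_onD[OF block_compl_inj] by blast
  have "1 - ?Q \<noteq> 0" by (rule qq_power_tt_power_neq_1) simp
  then have nz: "1 - inverse ?Q \<noteq> 0" "1 - ?Q \<noteq> 0" "?Q \<noteq> 0" by (auto simp: field_simps)
  have "invert_qt ?K = (1 - inverse tt) / (1 - inverse ?Q)"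
    by (simp add: invert_qt_divide I.hom_diff I.hom_mult I.hom_power power_inverse)
  also have "\<dots> = qq ^ h * tt ^ ?A * ?K"
  proof -
    have "(1 - inverse tt) * (1 - ?Q) = qq ^ h * tt ^ ?A * (1 - tt) * (1 - inverse ?Q)"
      by (simp add: field_simps)
    then show ?thesis using nz by (simp add: frac_eq_eq del: power_Suc)
  qed
  finally have K: "invert_qt ?K = qq ^ h * tt ^ ?A * ?K" .
  have pow: "(if y < z then qq ^ h else 1) = qq powi (int h * of_bool (y < z))" for y z :: nat
    by simp
  \<comment> \<open>This is \<open>block_compl_less\<close> for \<open>b\<close> and
    \<open>x\<close>, multiplied by the height.\<close>
  have "int h * of_bool (?c b < ?c x)
      = - (int h * of_bool (b < x)) + int h + int h * (of_bool (m < x) - of_bool (m < b))"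
  proof -
    have "k * A = - (k * B) + k + k * (C - D)" if "A = 1 - B + C - D" for A B C D k :: int
      by (simp add: that algebra_simps)
    then show ?thesis using block_compl_less[of b x] False assms by blast
  qed
  then have q: "qq powi (int h * of_bool (?c b < ?c x)) = inverse (qq powi (int h * of_bool (b < x)))
      * qq ^ h * qq powi (int h * (of_bool (m < x) - of_bool (m < b)))"
    by (simp only: power_int_add qq_neq_0 simp_thms power_int_minus power_int_of_nat)
  have t: "tt powi cyc_sum (?c x) (?c b) h (map (apfst ?c) r) = inverse (tt powi ?C) * tt ^ ?A"
    using cyc_sum_block_compl[OF assms(1,2) False assms(3-5)]
    by (simp add: power_int_diff divide_inverse mult.commute)
  have "step_weight (?c x) (?c b) h (map (apfst ?c) r)
      = qq powi (int h * of_bool (?c b < ?c x)) * tt powi cyc_sum (?c x) (?c b) h (map (apfst ?c) r) * ?K"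
    using ne unfolding step_weight_def pow by (simp only: num_lower_map_apfst if_False)
  also have "\<dots> = inverse (qq powi (int h * of_bool (b < x))) * inverse (tt powi ?C) * (qq ^ h * tt ^ ?A * ?K)
      * qq powi (int h * (of_bool (m < x) - of_bool (m < b)))"
    unfolding q t by (simp only: mult_ac)
  also have "inverse (qq powi (int h * of_bool (b < x))) * inverse (tt powi ?C) * (qq ^ h * tt ^ ?A * ?K)
      = invert_qt (step_weight x b h r)"
    using False unfolding K[symmetric] step_weight_def pow
    by (simp only: I.hom_mult invert_qt_power_int invert_qt_qq invert_qt_tt power_int_inverse if_False)
  finally show ?thesis .
qed

text \<open>Distinctness of the frontier values persists along the recursion and guarantees that the
  triples compared by \<open>cyc\<close> consist of distinct values whenever the new value differs
  from the one below.\<close>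

lemma gen_fun_block_compl:
  assumes "distinct (map fst w)" "fst ` set w \<subseteq> {1..n}"
  shows "gen_fun n (map (apfst (block_compl m n)) w)
    = cst (qq powi (- int (upper_height m w))) * block_subst m n (gen_fun n w)"
  using assms
proof (induction "state_size w" arbitrary: w rule: less_induct)
  case (less w)
  interpret I: unital_ring_hom invert_qt by (rule invert_qt_hom)
  interpret S: unital_ring_hom "block_subst m n" by (rule subst_poly_hom[OF invert_qt_hom])
  let ?c = "block_compl m n" and ?S = "block_subst m n"
  have S_xvar: "?S (xvar x) = cst (qq powi of_bool (m < x)) * xvar (?c x)" for x
    by (simp add: subst_poly_xvar[OF invert_qt_hom] block_compl_def)
  show ?case
  proof (cases w)
    case Nil
    then show ?thesis by simp
  next
    case (Cons p r)
    obtain b h where p: "p = (b, h)" by (cases p)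
    have b: "b \<in> {1..n}" "b \<notin> fst ` set r" and r: "fst ` set r \<subseteq> {1..n}" "distinct (map fst r)"
      using less.prems by (auto simp: Cons p)
    show ?thesis
    proof (cases h)
      case 0
      then show ?thesis using less.hyps[of r] r by (simp add: Cons p)
    next
      case (Suc k)
      let ?r = "map (apfst ?c) r" and ?V = "{1..n} - fst ` set r"
      let ?P = "\<lambda>w. cst (qq powi (- int (upper_height m w)))"
      let ?F = "\<lambda>x. cst (step_weight x b (Suc k) r) * (xvar x * gen_fun n (r @ [(x, k)]))"
      let ?F' = "\<lambda>x. cst (step_weight x (?c b) (Suc k) ?r) * (xvar x * gen_fun n (?r @ [(x, k)]))"
      have "fst ` set ?r = ?c ` fst ` set r" by force
      then have V: "{1..n} - fst ` set ?r = ?c ` ?V"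
        using block_compl_image inj_on_image_set_diff[OF block_compl_inj, of "{1..n}" "fst ` set r"] r
        by auto
      have "gen_fun n (map (apfst ?c) w) = sum ?F' (?c ` ?V)"
        unfolding Cons p Suc list.map apfst_conv gen_fun.simps V ..
      also have "\<dots> = (\<Sum>x\<in>?V. ?F' (?c x))"
        by (rule sum.reindex_cong[OF inj_on_subset[OF block_compl_inj]]) auto
      also have "\<dots> = (\<Sum>x\<in>?V. ?P w * ?S (?F x))"
      proof (rule sum.cong[OF refl])
        fix x assume x: "x \<in> ?V"
        have IH: "gen_fun n (?r @ [(?c x, k)]) = ?P (r @ [(x, k)]) * ?S (gen_fun n (r @ [(x, k)]))"
          using less.hyps[of "r @ [(x, k)]"] x r by (simp add: Cons p Suc)
        let ?e = "qq powi (int (Suc k) * (of_bool (m < x) - of_bool (m < b)))"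
        have wt: "step_weight (?c x) (?c b) (Suc k) ?r = invert_qt (step_weight x b (Suc k) r) * ?e"
          using x b r by (intro step_weight_block_compl) auto
        \<comment> \<open>Replacing \<open>(b, Suc k)\<close> by \<open>(x, k)\<close> changes the
          upper height by the exponent of \<open>?e\<close> less one unit if \<open>x\<close> is in
          the upper block. That unit is the factor q in the substituted variable.\<close>
        have "?e * qq powi (- int (upper_height m (r @ [(x, k)])))
            = qq powi (- int (upper_height m w)) * qq powi of_bool (m < x)"
          unfolding power_int_add[OF disjI1[OF qq_neq_0], symmetric]
          by (rule arg_cong) (simp add: Cons p Suc)
        then have e: "cst ?e * ?P (r @ [(x, k)]) = ?P w * cst (qq powi of_bool (m < x))"
          by (simp only: cst.hom_mult[symmetric])
        have "?F' (?c x) = (cst ?e * ?P (r @ [(x, k)])) * (cst (invert_qt (step_weight x b (Suc k) r))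
            * (xvar (?c x) * ?S (gen_fun n (r @ [(x, k)]))))"
          unfolding IH wt cst.hom_mult by (simp only: mult_ac)
        also have "\<dots> = ?P w * ?S (?F x)"
          unfolding e S.hom_mult S_xvar subst_poly_cst[OF invert_qt_hom] by (simp only: mult_ac)
        finally show "?F' (?c x) = ?P w * ?S (?F x)" .
      qed
      also have "\<dots> = ?P w * ?S (gen_fun n w)"
        unfolding Cons p Suc gen_fun.simps by (simp only: S.hom_sum sum_distrib_left)
      finally show ?thesis .
    qed
  qed
qed

end

section \<open>Fillings and the recursion\<close>

text \<open>The attack relation is oriented by the filling order: only the boxes filled before
  \<open>u\<close> are listed, so each attacking pair is recorded once, at its later member.\<close>

definition attacked :: "nat \<Rightarrow> (nat \<Rightarrow> nat) \<Rightarrow> box \<Rightarrow> box set" where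
  "attacked n \<mu> u = {w \<in> dg_hat n \<mu>.
     snd w = snd u \<and> fst w < fst u \<or> Suc (snd w) = snd u \<and> fst u < fst w}"

text \<open>A box one row lower has one more unit of leg, so the single comparison of legs means
  \<le> for columns to the left and < for columns to the right, as in the arm.\<close>

definition arm_set :: "nat \<Rightarrow> (nat \<Rightarrow> nat) \<Rightarrow> box \<Rightarrow> box set" where
  "arm_set n \<mu> u = {w \<in> attacked n \<mu> u. leg \<mu> w \<le> leg \<mu> u}"

definition box_weight :: "nat \<Rightarrow> (nat \<Rightarrow> nat) \<Rightarrow> (box \<Rightarrow> nat) \<Rightarrow> box \<Rightarrow> ratfun" where
  "box_weight n \<mu> \<sigma> u =
     (if \<sigma> (below u) < \<sigma> u then qq ^ (leg \<mu> u + 1) else 1) *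
     tt powi (\<Sum>w\<in>arm_set n \<mu> u. cyc (\<sigma> u) (\<sigma> w) (\<sigma> (below u))) *
     (if \<sigma> u = \<sigma> (below u) then 1
      else (1 - tt) / (1 - qq ^ (leg \<mu> u + 1) * tt ^ (arm n \<mu> u + 1)))"

section \<open>Arms, inversions and the weight of a single filling\<close>

lemma in_dg_iff: "(i, j) \<in> dg n \<mu> \<longleftrightarrow> 1 \<le> i \<and> i \<le> n \<and> 1 \<le> j \<and> j \<le> \<mu> i"
  by (simp add: dg_def)

lemma in_dg_hat_iff: "(i, j) \<in> dg_hat n \<mu> \<longleftrightarrow> 1 \<le> i \<and> i \<le> n \<and> j \<le> \<mu> i"
  by (auto simp: dg_hat_def dg_def)

lemma finite_dg_hat [simp]: "finite (dg_hat n \<mu>)"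
proof (rule finite_subset)
  show "dg_hat n \<mu> \<subseteq> (SIGMA i:{1..n}. {..\<mu> i})" by (auto simp: in_dg_hat_iff)
qed simp

lemma finite_dg [simp]: "finite (dg n \<mu>)"
  by (rule finite_subset[OF _ finite_dg_hat[of n \<mu>]]) (auto simp: dg_hat_def)

lemma finite_attacked [simp]: "finite (attacked n \<mu> u)"
  by (simp add: attacked_def)

lemma finite_arm_set [simp]: "finite (arm_set n \<mu> u)"
  by (simp add: arm_set_def)

lemma in_arm_set_iff:
  assumes "(a, b) \<in> dg n \<mu>"
  shows "(c, d) \<in> arm_set n \<mu> (a, b) \<longleftrightarrow> 1 \<le> c \<and> c \<le> n \<and> d \<le> \<mu> c \<and>
    (b = d \<and> c < a \<and> \<mu> c \<le> \<mu> a \<or> b = Suc d \<and> a < c \<and> \<mu> c < \<mu> a)"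
  using assms by (auto simp: arm_set_def attacked_def leg_def in_dg_iff in_dg_hat_iff)

lemma card_arm_set:
  assumes "u \<in> dg n \<mu>" shows "card (arm_set n \<mu> u) = arm n \<mu> u"
proof -
  obtain a b where u: "u = (a, b)" by (cases u)
  let ?A = "{i'. (i', b) \<in> dg n \<mu> \<and> i' < a \<and> \<mu> i' \<le> \<mu> a}"
  let ?B = "{i'. (i', b - 1) \<in> dg_hat n \<mu> \<and> i' > a \<and> \<mu> i' < \<mu> a}"
  have b: "1 \<le> b" using assms by (simp add: u in_dg_iff)
  have fin: "finite ?A" "finite ?B"
    by (rule finite_subset[of _ "{1..n}"]; auto simp: in_dg_iff in_dg_hat_iff)+
  have "arm_set n \<mu> u = (\<lambda>i. (i, b)) ` ?A \<union> (\<lambda>i. (i, b - 1)) ` ?B"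
  proof (rule set_eqI)
    fix w :: box
    obtain c d where w: "w = (c, d)" by (cases w)
    show "w \<in> arm_set n \<mu> u \<longleftrightarrow> w \<in> (\<lambda>i. (i, b)) ` ?A \<union> (\<lambda>i. (i, b - 1)) ` ?B"
      using assms unfolding u w
      by (subst in_arm_set_iff) (auto simp: in_dg_iff in_dg_hat_iff)
  qed
  moreover have "(\<lambda>i. (i, b)) ` ?A \<inter> (\<lambda>i. (i, b - 1)) ` ?B = {}" using b by auto
  ultimately have "card (arm_set n \<mu> u) = card ((\<lambda>i. (i, b)) ` ?A) + card ((\<lambda>i. (i, b - 1)) ` ?B)"
    using fin by (simp add: card_Un_disjoint)
  also have "\<dots> = card ?A + card ?B" by (simp add: card_image inj_on_def)
  finally show ?thesis by (simp add: arm_def u)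
qed

text \<open>Every attacking pair is the pair \<open>(u, w)\<close> or \<open>(w, below u)\<close> of exactly one triple with
  \<open>w \<in> arm_set n \<mu> u\<close>, except for the pairs in the basement whose right column is not lower than
  the left one.\<close>

lemma card_inversion_pairs:
  assumes basement: "\<And>i. i \<in> {1..n} \<Longrightarrow> \<sigma> (i, 0) = i"
  shows "int (card (inversion_pairs n \<mu> \<sigma>))
    = (\<Sum>u\<in>dg n \<mu>. \<Sum>w\<in>arm_set n \<mu> u. of_bool (\<sigma> w < \<sigma> u) + of_bool (\<sigma> (below u) < \<sigma> w))
      + int (card {(i, j). 1 \<le> i \<and> i < j \<and> j \<le> n \<and> \<mu> i \<le> \<mu> j \<and> id i < id j})"
proof -
  define P where "P = (SIGMA u:dg n \<mu>. arm_set n \<mu> u)"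
  define X where "X = {p \<in> P. \<sigma> (snd p) < \<sigma> (fst p)}"
  define Y' where "Y' = {p \<in> P. \<sigma> (below (fst p)) < \<sigma> (snd p)}"
  define Y where "Y = (\<lambda>(u, w). (w, below u)) ` Y'"
  define Z' where "Z' = {(i, j). 1 \<le> i \<and> i < j \<and> j \<le> n \<and> \<mu> i \<le> \<mu> j \<and> id i < id j}"
  define Z where "Z = (\<lambda>(i, j). ((j, 0::nat), (i, 0::nat))) ` Z'"
  have fP: "finite P" by (simp add: P_def)
  have fin: "finite X" "finite Y'" using fP by (simp_all add: X_def Y'_def)
  have "finite Z'" by (rule finite_subset[of _ "{1..n} \<times> {1..n}"]) (auto simp: Z'_def)
  then have fin': "finite Y" "finite Z" using fin by (simp_all add: Y_def Z_def)
  have X: "((a, b), (c, d)) \<in> X \<longleftrightarrow> (a, b) \<in> dg n \<mu> \<and> 1 \<le> c \<and> c \<le> n \<and> d \<le> \<mu> c \<and>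
      (b = d \<and> c < a \<and> \<mu> c \<le> \<mu> a \<or> b = Suc d \<and> a < c \<and> \<mu> c < \<mu> a) \<and> \<sigma> (c, d) < \<sigma> (a, b)"
    for a b c d
    by (auto simp: X_def P_def in_arm_set_iff)
  have "((a, b), (c, d)) \<in> Y \<longleftrightarrow> ((c, Suc d), (a, b)) \<in> Y'" for a b c d
  proof
    assume "((a, b), (c, d)) \<in> Y"
    then obtain a' b' where "((a', b'), (a, b)) \<in> Y'" "below (a', b') = (c, d)" by (auto simp: Y_def)
    moreover have "1 \<le> b'" using calculation(1) by (auto simp: Y'_def P_def in_dg_iff)
    ultimately show "((c, Suc d), (a, b)) \<in> Y'" by (auto simp: below_def)
  next
    assume "((c, Suc d), (a, b)) \<in> Y'"
    then show "((a, b), (c, d)) \<in> Y"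
      unfolding Y_def by (intro image_eqI[of _ _ "((c, Suc d), (a, b))"]) (simp_all add: below_def)
  qed
  then have Y: "((a, b), (c, d)) \<in> Y \<longleftrightarrow> (c, Suc d) \<in> dg n \<mu> \<and> 1 \<le> a \<and> a \<le> n \<and> b \<le> \<mu> a \<and>
      (Suc d = b \<and> a < c \<and> \<mu> a \<le> \<mu> c \<or> d = b \<and> c < a \<and> \<mu> a < \<mu> c) \<and> \<sigma> (c, d) < \<sigma> (a, b)"
    for a b c d
    by (auto simp: Y'_def P_def in_arm_set_iff below_def)
  have Z: "((a, b), (c, d)) \<in> Z \<longleftrightarrow> b = 0 \<and> d = 0 \<and> 1 \<le> c \<and> c < a \<and> a \<le> n \<and> \<mu> c \<le> \<mu> a" for a b c d
    by (auto simp: Z_def Z'_def image_iff)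
  have I: "((a, b), (c, d)) \<in> inversion_pairs n \<mu> \<sigma> \<longleftrightarrow> 1 \<le> a \<and> a \<le> n \<and> b \<le> \<mu> a \<and>
      1 \<le> c \<and> c \<le> n \<and> d \<le> \<mu> c \<and> (b = d \<and> c < a \<or> b = Suc d \<and> a < c) \<and> \<sigma> (c, d) < \<sigma> (a, b)"
    for a b c d
    by (auto simp: inversion_pairs_def in_dg_hat_iff attacking_def reads_before_def)
  have "((a, b), (c, d)) \<in> inversion_pairs n \<mu> \<sigma> \<longleftrightarrow> ((a, b), (c, d)) \<in> X \<union> Y \<union> Z" for a b c d
  proof (cases "b = 0 \<and> d = 0")
    case True
    \<comment> \<open>Basement values increase from left to right, so all basement pairs are
      inversions: those with a strictly higher left column lie in \<open>Y\<close>, the others form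
      \<open>Z\<close>.\<close>
    then show ?thesis using basement unfolding Un_iff I X Y Z in_dg_iff by auto
  next
    case False
    then show ?thesis unfolding Un_iff I X Y Z in_dg_iff by auto
  qed
  then have "inversion_pairs n \<mu> \<sigma> = X \<union> Y \<union> Z" by (auto simp only: split_paired_all set_eq_iff)
  moreover have "X \<inter> Y = {}"
  proof -
    have "((a, b), (c, d)) \<notin> X \<inter> Y" for a b c d unfolding Int_iff X Y in_dg_iff by auto
    then show ?thesis by fast
  qed
  moreover have "(X \<union> Y) \<inter> Z = {}"
  proof -
    have "((a, b), (c, d)) \<notin> (X \<union> Y) \<inter> Z" for a b c d unfolding Int_iff Un_iff X Y Z in_dg_iff by auto
    then show ?thesis by fast
  qed
  ultimately have "card (inversion_pairs n \<mu> \<sigma>) = card X + card Y + card Z"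
    using fin fin' by (simp add: card_Un_disjoint)
  also have "card Z = card Z'" unfolding Z_def by (rule card_image) (auto simp: inj_on_def)
  also have "card Y = card Y'" unfolding Y_def
  proof (rule card_image)
    show "inj_on (\<lambda>(u, w). (w, below u)) Y'"
      by (auto simp: inj_on_def Y'_def P_def below_def in_dg_iff)
  qed
  finally have c: "int (card (inversion_pairs n \<mu> \<sigma>)) = int (card X) + int (card Y') + int (card Z')"
    by simp
  have "int (card X) = (\<Sum>p\<in>P. of_bool (\<sigma> (snd p) < \<sigma> (fst p)))"
    unfolding X_def using fP by (simp add: Int_def)
  moreover have "int (card Y') = (\<Sum>p\<in>P. of_bool (\<sigma> (below (fst p)) < \<sigma> (snd p)))"
    unfolding Y'_def using fP by (simp add: Int_def)
  moreover have "(\<Sum>p\<in>P. f p) = (\<Sum>u\<in>dg n \<mu>. \<Sum>w\<in>arm_set n \<mu> u. f (u, w))" for f :: "box \<times> box \<Rightarrow> int"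
    unfolding P_def by (subst sum.Sigma) (auto simp: case_prod_beta)
  ultimately show ?thesis
    unfolding c Z'_def by (simp only: fst_conv snd_conv sum.distrib)
qed

text \<open>Writing arms as cardinalities of arm sets turns all terms into sums over triples, and
  the basement correction in \<open>inv_stat\<close> cancels the pairs that belong to no
  triple.\<close>

lemma coinv_stat_eq:
  assumes "\<And>i. i \<in> {1..n} \<Longrightarrow> \<sigma> (i, 0) = i"
  shows "coinv_stat n id \<mu> \<sigma> = (\<Sum>u\<in>dg n \<mu>. \<Sum>w\<in>arm_set n \<mu> u. cyc (\<sigma> u) (\<sigma> w) (\<sigma> (below u)))"
proof -
  let ?A = "\<lambda>u. int (arm n \<mu> u)"
  have "int (\<Sum>u\<in>descents n \<mu> \<sigma>. arm n \<mu> u) = (\<Sum>u\<in>dg n \<mu>. of_bool (\<sigma> (below u) < \<sigma> u) * ?A u)"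
    unfolding descents_def
    by (simp add: sum.inter_filter of_bool_def if_distrib[of "\<lambda>x. x * _"] if_distrib[of int]
        cong: if_cong)
  then have "coinv_stat n id \<mu> \<sigma> = (\<Sum>u\<in>dg n \<mu>. ?A u + of_bool (\<sigma> (below u) < \<sigma> u) * ?A u
      - (\<Sum>w\<in>arm_set n \<mu> u. of_bool (\<sigma> w < \<sigma> u) + of_bool (\<sigma> (below u) < \<sigma> w)))"
    using card_inversion_pairs[OF assms, where \<mu> = \<mu>]
    by (simp add: coinv_stat_def inv_stat_def sum_subtractf sum.distrib)
  also have "\<dots> = (\<Sum>u\<in>dg n \<mu>. \<Sum>w\<in>arm_set n \<mu> u. cyc (\<sigma> u) (\<sigma> w) (\<sigma> (below u)))"
    by (rule sum.cong[OF refl])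
      (simp add: cyc_def sum_subtractf sum.distrib card_arm_set algebra_simps)
  finally show ?thesis .
qed

lemma power_int_sum: "x \<noteq> 0 \<Longrightarrow> x powi (\<Sum>a\<in>A. f a) = (\<Prod>a\<in>A. x powi f a)" for x :: ratfun
  by (induction A rule: infinite_finite_induct) (simp_all add: power_int_add)

lemma macdonald_E_eq_box_weights:
  "macdonald_E n \<mu> = (\<Sum>\<sigma>\<in>NAF n id \<mu>. \<Prod>u\<in>dg n \<mu>. cst (box_weight n \<mu> \<sigma> u) * xvar (\<sigma> u))"
  unfolding macdonald_E_def
proof (rule sum.cong[OF refl])
  fix \<sigma> assume \<sigma>: "\<sigma> \<in> NAF n id \<mu>"
  have "qq ^ maj_stat n \<mu> \<sigma> = (\<Prod>u\<in>dg n \<mu>. if \<sigma> (below u) < \<sigma> u then qq ^ (leg \<mu> u + 1) else 1)"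
    unfolding maj_stat_def descents_def power_sum by (rule prod.inter_filter) simp
  moreover have "tt powi coinv_stat n id \<mu> \<sigma>
      = (\<Prod>u\<in>dg n \<mu>. tt powi (\<Sum>w\<in>arm_set n \<mu> u. cyc (\<sigma> u) (\<sigma> w) (\<sigma> (below u))))"
    using \<sigma> by (subst coinv_stat_eq) (auto simp: NAF_def power_int_sum)
  moreover have "(\<Prod>u\<in>{u \<in> dg n \<mu>. \<sigma> u \<noteq> \<sigma> (below u)}.
        (1 - tt) / (1 - qq ^ (leg \<mu> u + 1) * tt ^ (arm n \<mu> u + 1)))
      = (\<Prod>u\<in>dg n \<mu>. if \<sigma> u = \<sigma> (below u) then 1
          else (1 - tt) / (1 - qq ^ (leg \<mu> u + 1) * tt ^ (arm n \<mu> u + 1)))"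
    by (subst prod.inter_filter) (auto intro!: prod.cong)
  ultimately show "cst (qq ^ maj_stat n \<mu> \<sigma> * tt powi coinv_stat n id \<mu> \<sigma> *
        (\<Prod>u\<in>{u \<in> dg n \<mu>. \<sigma> u \<noteq> \<sigma> (below u)}.
           (1 - tt) / (1 - qq ^ (leg \<mu> u + 1) * tt ^ (arm n \<mu> u + 1)))) * (\<Prod>u\<in>dg n \<mu>. xvar (\<sigma> u))
      = (\<Prod>u\<in>dg n \<mu>. cst (box_weight n \<mu> \<sigma> u) * xvar (\<sigma> u))"
    by (simp only: box_weight_def prod.distrib cst.hom_prod[symmetric])
qed

text \<open>Fillings are total functions here: \<open>\<tau>\<close> supplies the boxes already
  filled and also all points off the diagram. Filling \<open>u\<close> then means passing to
  \<open>\<tau>(u := x)\<close> and \<open>B - {u}\<close>.\<close>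

definition extensions :: "nat \<Rightarrow> (nat \<Rightarrow> nat) \<Rightarrow> box set \<Rightarrow> (box \<Rightarrow> nat) \<Rightarrow> (box \<Rightarrow> nat) set" where
  "extensions n \<mu> B \<tau> = {\<sigma>. (\<forall>u. u \<notin> B \<longrightarrow> \<sigma> u = \<tau> u) \<and>
     (\<forall>u\<in>B. \<sigma> u \<in> {1..n} - \<sigma> ` attacked n \<mu> u)}"

definition extension_sum :: "nat \<Rightarrow> (nat \<Rightarrow> nat) \<Rightarrow> box set \<Rightarrow> (box \<Rightarrow> nat) \<Rightarrow> mpol" where
  "extension_sum n \<mu> B \<tau> =
     (\<Sum>\<sigma>\<in>extensions n \<mu> B \<tau>. \<Prod>u\<in>B. cst (box_weight n \<mu> \<sigma> u) * xvar (\<sigma> u))"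

lemma extensions_outside: "\<sigma> \<in> extensions n \<mu> B \<tau> \<Longrightarrow> v \<notin> B \<Longrightarrow> \<sigma> v = \<tau> v"
  unfolding extensions_def by blast

lemma finite_extensions:
  assumes "finite B" shows "finite (extensions n \<mu> B \<tau>)"
proof (rule finite_subset)
  show "extensions n \<mu> B \<tau> \<subseteq> (\<lambda>f u. if u \<in> B then f u else \<tau> u) ` (B \<rightarrow>\<^sub>E {1..n})"
  proof
    fix \<sigma> assume \<sigma>: "\<sigma> \<in> extensions n \<mu> B \<tau>"
    then have "\<sigma> = (\<lambda>u. if u \<in> B then restrict \<sigma> B u else \<tau> u)" "restrict \<sigma> B \<in> B \<rightarrow>\<^sub>E {1..n}"
      by (auto simp: extensions_def)
    then show "\<sigma> \<in> (\<lambda>f u. if u \<in> B then f u else \<tau> u) ` (B \<rightarrow>\<^sub>E {1..n})" by blast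
  qed
  show "finite ((\<lambda>f u. if u \<in> B then f u else \<tau> u) ` (B \<rightarrow>\<^sub>E {1..n}))"
    using assms by (intro finite_imageI finite_PiE) auto
qed

lemma box_weight_cong:
  assumes "\<sigma> u = \<tau> u" "\<sigma> (below u) = \<tau> (below u)" "\<And>w. w \<in> attacked n \<mu> u \<Longrightarrow> \<sigma> w = \<tau> w"
  shows "box_weight n \<mu> \<sigma> u = box_weight n \<mu> \<tau> u"
proof -
  have "(\<Sum>w\<in>arm_set n \<mu> u. cyc (\<sigma> u) (\<sigma> w) (\<sigma> (below u)))
      = (\<Sum>w\<in>arm_set n \<mu> u. cyc (\<tau> u) (\<tau> w) (\<tau> (below u)))"
    using assms by (intro sum.cong) (auto simp: arm_set_def)
  then show ?thesis by (simp add: box_weight_def assms(1,2))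
qed

text \<open>If the box below \<open>u\<close> and all boxes in \<open>attacked n \<mu> u\<close> are
  settled, then \<open>\<tau>\<close> determines both the forbidden values at \<open>u\<close> and,
  once \<open>x\<close> is chosen, its weight. The sum splits according to \<open>x\<close>.\<close>

lemma extension_sum_step:
  assumes B: "finite B" "u \<in> B" "below u \<notin> B" "attacked n \<mu> u \<inter> B = {}"
  shows "extension_sum n \<mu> B \<tau> = (\<Sum>x\<in>{1..n} - \<tau> ` attacked n \<mu> u.
    cst (box_weight n \<mu> (\<tau>(u := x)) u) * (xvar x * extension_sum n \<mu> (B - {u}) (\<tau>(u := x))))"
proof -
  let ?X = "{1..n} - \<tau> ` attacked n \<mu> u" and ?E = "\<lambda>x. extensions n \<mu> (B - {u}) (\<tau>(u := x))"
  let ?W = "\<lambda>\<sigma> u. cst (box_weight n \<mu> \<sigma> u) * xvar (\<sigma> u)"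
  have "extensions n \<mu> B \<tau> = (\<Union>x\<in>?X. ?E x)"
  proof (rule set_eqI)
    fix \<sigma>
    have im: "\<sigma> ` attacked n \<mu> u = \<tau> ` attacked n \<mu> u" if "\<And>v. v \<notin> B \<Longrightarrow> \<sigma> v = \<tau> v"
      using B(4) that by (intro image_cong) auto
    show "\<sigma> \<in> extensions n \<mu> B \<tau> \<longleftrightarrow> \<sigma> \<in> (\<Union>x\<in>?X. ?E x)"
    proof
      assume \<sigma>: "\<sigma> \<in> extensions n \<mu> B \<tau>"
      then have "\<sigma> u \<in> ?X" using B(2) im by (auto simp: extensions_def)
      moreover have "\<sigma> \<in> ?E (\<sigma> u)" using \<sigma> by (auto simp: extensions_def)
      ultimately show "\<sigma> \<in> (\<Union>x\<in>?X. ?E x)" by blast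
    next
      assume "\<sigma> \<in> (\<Union>x\<in>?X. ?E x)"
      then obtain x where x: "x \<in> ?X" and \<sigma>: "\<sigma> \<in> ?E x" by blast
      have off: "\<sigma> v = \<tau> v" if "v \<notin> B" for v
      proof -
        have "v \<notin> B - {u}" "v \<noteq> u" using that B(2) by auto
        then show ?thesis using extensions_outside[OF \<sigma>] by simp
      qed
      have "\<sigma> u = x" using extensions_outside[OF \<sigma>] by simp
      then have "\<sigma> u \<in> {1..n} - \<sigma> ` attacked n \<mu> u" using x im[OF off] by simp
      then show "\<sigma> \<in> extensions n \<mu> B \<tau>" using \<sigma> off unfolding extensions_def by auto
    qed
  qed
  then have "extension_sum n \<mu> B \<tau> = (\<Sum>\<sigma>\<in>(\<Union>x\<in>?X. ?E x). \<Prod>v\<in>B. ?W \<sigma> v)"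
    by (simp add: extension_sum_def)
  also have "\<dots> = (\<Sum>x\<in>?X. \<Sum>\<sigma>\<in>?E x. \<Prod>v\<in>B. ?W \<sigma> v)"
  proof (rule sum.UNION_disjoint)
    show "\<forall>x\<in>?X. finite (?E x)" using B(1) by (simp add: finite_extensions)
    have "\<sigma> u = x" if "\<sigma> \<in> ?E x" for \<sigma> x using extensions_outside[OF that] by simp
    then show "\<forall>x\<in>?X. \<forall>y\<in>?X. x \<noteq> y \<longrightarrow> ?E x \<inter> ?E y = {}" by blast
  qed simp
  also have "\<dots> = (\<Sum>x\<in>?X. cst (box_weight n \<mu> (\<tau>(u := x)) u) *
      (xvar x * extension_sum n \<mu> (B - {u}) (\<tau>(u := x))))"
  proof (rule sum.cong[OF refl])
    fix x assume "x \<in> ?X"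
    have "(\<Prod>v\<in>B. ?W \<sigma> v) = cst (box_weight n \<mu> (\<tau>(u := x)) u) * (xvar x * (\<Prod>v\<in>B - {u}. ?W \<sigma> v))"
      if \<sigma>: "\<sigma> \<in> ?E x" for \<sigma>
    proof -
      have off: "\<sigma> v = (\<tau>(u := x)) v" if "v \<notin> B - {u}" for v
        by (rule extensions_outside[OF \<sigma> that])
      have "box_weight n \<mu> \<sigma> u = box_weight n \<mu> (\<tau>(u := x)) u"
        using B by (intro box_weight_cong off) auto
      moreover have "\<sigma> u = x" using off[of u] by simp
      ultimately show ?thesis using B by (subst prod.remove[of B u]) (auto simp: mult.assoc)
    qed
    then show "(\<Sum>\<sigma>\<in>?E x. \<Prod>v\<in>B. ?W \<sigma> v) = cst (box_weight n \<mu> (\<tau>(u := x)) u) *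
        (xvar x * extension_sum n \<mu> (B - {u}) (\<tau>(u := x)))"
      by (simp add: extension_sum_def sum_distrib_left)
  qed
  finally show ?thesis .
qed

text \<open>Boxes are filled row by row from the bottom, from left to right. When the box \<open>(i, j)\<close> is
  next, the frontier consists of the topmost filled box of every column that reaches row \<open>j - 1\<close>
  (columns \<open>\<ge> i\<close>) or row \<open>j\<close> (columns \<open>< i\<close>).\<close>

definition frontier :: "nat \<Rightarrow> (nat \<Rightarrow> nat) \<Rightarrow> nat \<Rightarrow> nat \<Rightarrow> box list" where
  "frontier n \<mu> i j = filter (\<lambda>u. u \<in> dg_hat n \<mu>)
     (map (\<lambda>k. (k, j - 1)) [i..<Suc n] @ map (\<lambda>k. (k, j)) [1..<i])"

definition remaining :: "nat \<Rightarrow> (nat \<Rightarrow> nat) \<Rightarrow> nat \<Rightarrow> nat \<Rightarrow> box set" where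
  "remaining n \<mu> i j = {u \<in> dg n \<mu>. j < snd u \<or> snd u = j \<and> i \<le> fst u}"

definition frontier_state :: "(nat \<Rightarrow> nat) \<Rightarrow> (box \<Rightarrow> nat) \<Rightarrow> box list \<Rightarrow> state" where
  "frontier_state \<mu> \<tau> us = map (\<lambda>u. (\<tau> u, leg \<mu> u)) us"

lemma finite_remaining [simp]: "finite (remaining n \<mu> i j)"
  by (simp add: remaining_def)

lemma cyc_sum_frontier_state:
  assumes "distinct us"
  shows "cyc_sum x b h (frontier_state \<mu> \<tau> us) = (\<Sum>w\<in>{w \<in> set us. leg \<mu> w < h}. cyc x (\<tau> w) b)"
proof -
  have "cyc_sum x b h (frontier_state \<mu> \<tau> us) = (\<Sum>w\<leftarrow>us. if leg \<mu> w < h then cyc x (\<tau> w) b else 0)"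
    by (simp add: cyc_sum_def frontier_state_def comp_def)
  also have "\<dots> = (\<Sum>w\<in>set us. if leg \<mu> w < h then cyc x (\<tau> w) b else 0)"
    by (rule sum_list_distinct_conv_sum_set[OF assms])
  finally show ?thesis by (simp add: sum.inter_filter)
qed

lemma num_lower_frontier_state:
  assumes "distinct us"
  shows "num_lower h (frontier_state \<mu> \<tau> us) = card {w \<in> set us. leg \<mu> w < h}"
  using assms distinct_card[of "filter (\<lambda>w. leg \<mu> w < h) us"]
  by (simp add: num_lower_def frontier_state_def filter_map comp_def)

lemma box_weight_step_weight:
  assumes u: "u \<in> dg n \<mu>" and us: "distinct us" "set us = attacked n \<mu> u" and b: "below u \<noteq> u"
  shows "box_weight n \<mu> (\<tau>(u := x)) u
    = step_weight x (\<tau> (below u)) (Suc (leg \<mu> u)) (frontier_state \<mu> \<tau> us)"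
proof -
  have arm: "{w \<in> set us. leg \<mu> w < Suc (leg \<mu> u)} = arm_set n \<mu> u"
    by (auto simp: arm_set_def us)
  have "(\<Sum>w\<in>arm_set n \<mu> u. cyc x ((\<tau>(u := x)) w) (\<tau> (below u)))
      = (\<Sum>w\<in>arm_set n \<mu> u. cyc x (\<tau> w) (\<tau> (below u)))"
    by (intro sum.cong) (auto simp: arm_set_def attacked_def)
  then show ?thesis
    using b unfolding box_weight_def step_weight_def cyc_sum_frontier_state[OF us(1)]
      num_lower_frontier_state[OF us(1)] arm card_arm_set[OF u] by simp
qed

lemma extension_sum_eq_gen_fun_step:
  assumes ij: "1 \<le> i" "i \<le> n" "1 \<le> j"
    and IH: "\<And>\<tau>. extension_sum n \<mu> (remaining n \<mu> (Suc i) j) \<tau>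
      = gen_fun n (frontier_state \<mu> \<tau> (frontier n \<mu> (Suc i) j))"
  shows "extension_sum n \<mu> (remaining n \<mu> i j) \<tau>
    = gen_fun n (frontier_state \<mu> \<tau> (frontier n \<mu> i j))"
proof -
  let ?u = "(i, j)"
  define R where "R = filter (\<lambda>u. u \<in> dg_hat n \<mu>)
     (map (\<lambda>k. (k, j - 1)) [Suc i..<Suc n] @ map (\<lambda>k. (k, j)) [1..<i])"
  have fr: "frontier n \<mu> i j = (if (i, j - 1) \<in> dg_hat n \<mu> then (i, j - 1) # R else R)"
    using ij by (simp add: frontier_def R_def upt_conv_Cons del: upt_Suc)
  have fr': "frontier n \<mu> (Suc i) j = (if ?u \<in> dg_hat n \<mu> then R @ [?u] else R)"
    using ij by (simp add: frontier_def R_def del: upt_Suc) (simp add: upt_Suc)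
  show ?thesis
  proof (cases "?u \<in> dg n \<mu>")
    case True
    let ?B = "remaining n \<mu> i j"
    have hat: "?u \<in> dg_hat n \<mu>" "(i, j - 1) \<in> dg_hat n \<mu>"
      using True by (auto simp: in_dg_iff in_dg_hat_iff)
    have R: "distinct R" "set R = attacked n \<mu> ?u"
      using ij by (auto simp: R_def attacked_def distinct_map inj_on_def in_dg_hat_iff image_iff
          simp del: upt_Suc)
    have below: "below ?u = (i, j - 1)" "below ?u \<noteq> ?u" using ij by (auto simp: below_def)
    have rem: "?B - {?u} = remaining n \<mu> (Suc i) j"
      by (auto simp: remaining_def)
    have leg: "leg \<mu> (i, j - 1) = Suc (leg \<mu> ?u)" using True by (auto simp: leg_def in_dg_iff)
    have nR: "?u \<notin> set R" by (simp add: R(2) attacked_def)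
    have st: "frontier_state \<mu> (\<tau>(?u := x)) (R @ [?u]) = frontier_state \<mu> \<tau> R @ [(x, leg \<mu> ?u)]" for x
      using nR by (auto simp: frontier_state_def)
    have im: "fst ` set (frontier_state \<mu> \<tau> R) = \<tau> ` attacked n \<mu> ?u"
      by (auto simp: frontier_state_def R(2) image_image)
    have "extension_sum n \<mu> ?B \<tau> = (\<Sum>x\<in>{1..n} - \<tau> ` attacked n \<mu> ?u.
        cst (box_weight n \<mu> (\<tau>(?u := x)) ?u) * (xvar x * extension_sum n \<mu> (?B - {?u}) (\<tau>(?u := x))))"
      using True ij by (intro extension_sum_step) (auto simp: remaining_def below_def attacked_def)
    also have "\<dots> = gen_fun n ((\<tau> (below ?u), Suc (leg \<mu> ?u)) # frontier_state \<mu> \<tau> R)"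
      unfolding gen_fun.simps im rem IH fr' if_P[OF hat(1)] st box_weight_step_weight[OF True R below(2)] ..
    also have "(\<tau> (below ?u), Suc (leg \<mu> ?u)) # frontier_state \<mu> \<tau> R
        = frontier_state \<mu> \<tau> (frontier n \<mu> i j)"
      unfolding fr if_P[OF hat(2)] by (simp add: frontier_state_def below leg[simplified])
    finally show ?thesis .
  next
    case False
    \<comment> \<open>Either column \<open>i\<close> ends in row \<open>j - 1\<close> and stands at
      the front with height 0, where the recursion drops it, or it is shorter and already absent
      from the frontier.\<close>
    then have lt: "\<mu> i < j" using ij by (auto simp: in_dg_iff)
    then have "?u \<notin> dg_hat n \<mu>" by (simp add: in_dg_hat_iff)
    moreover have "remaining n \<mu> i j = remaining n \<mu> (Suc i) j"
      using False by (auto simp: remaining_def) (metis Suc_leI le_neq_implies_less)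
    moreover have "leg \<mu> (i, j - 1) = 0" using lt by (simp add: leg_def)
    ultimately show ?thesis by (simp add: IH fr fr' frontier_state_def)
  qed
qed

lemma extension_sum_eq_gen_fun:
  assumes "1 \<le> i" "i \<le> Suc n" "1 \<le> j"
  shows "extension_sum n \<mu> (remaining n \<mu> i j) \<tau>
    = gen_fun n (frontier_state \<mu> \<tau> (frontier n \<mu> i j))"
proof -
  define M where "M = Max (\<mu> ` {1..n} \<union> {0})"
  have M: "\<mu> k \<le> M" if "k \<in> {1..n}" for k using that unfolding M_def by (intro Max_ge) auto
  let ?P = "\<lambda>i j. \<forall>\<tau>. extension_sum n \<mu> (remaining n \<mu> i j) \<tau>
    = gen_fun n (frontier_state \<mu> \<tau> (frontier n \<mu> i j))"
  have row: "?P i j" if last: "?P (Suc n) j" and i: "i \<le> Suc n" "1 \<le> i" and j: "1 \<le> j" for i j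
    using i
  proof (induction rule: inc_induct)
    case base
    show ?case by (rule last)
  next
    case (step k)
    then show ?case using extension_sum_eq_gen_fun_step[of k n j \<mu>] j by simp
  qed
  \<comment> \<open>The frontier also looks at row \<open>j - 1\<close>, which is empty only above
    the maximal height \<open>M\<close>; hence the bound \<open>M + 2\<close>.\<close>
  have high: "?P i j" if "M + 2 \<le> j" for i j
  proof -
    have "remaining n \<mu> i j = {}" "frontier n \<mu> i j = []"
      using that M by (fastforce simp: remaining_def frontier_def in_dg_iff in_dg_hat_iff filter_empty_conv)+
    moreover have "extensions n \<mu> {} \<tau> = {\<tau>}" for \<tau> by (auto simp: extensions_def fun_eq_iff)
    ultimately show ?thesis by (simp add: extension_sum_def frontier_state_def)
  qed
  \<comment> \<open>Being past the last column of a row is the same as standing at the first column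
    of the next row, which links the induction on columns to the induction on rows.\<close>
  have next_row: "remaining n \<mu> (Suc n) j = remaining n \<mu> 1 (Suc j)"
    "frontier n \<mu> (Suc n) j = frontier n \<mu> 1 (Suc j)" for j
    by (auto simp: remaining_def frontier_def in_dg_iff simp del: upt_Suc)
  have "\<forall>i\<in>{1..Suc n}. ?P i j" if "j \<le> M + 2" "1 \<le> j" for j
    using that
  proof (induction rule: inc_induct)
    case base
    then show ?case using high by blast
  next
    case (step k)
    then have "?P 1 (Suc k)" by simp
    then have "?P (Suc n) k" unfolding next_row .
    then show ?case using row step.prems by simp
  qed
  then show ?thesis using high[of j i] assms by (cases "j \<le> M + 2") auto
qed

text \<open>On the basement \<open>fst u\<close> is the identity labelling, and
  \<open>undefined\<close> off the diagram matches the convention for extensional functions.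
  Orienting the attacks loses nothing, as basement values are distinct anyway.\<close>

lemma NAF_eq_extensions:
  "NAF n id \<mu> = extensions n \<mu> (dg n \<mu>) (\<lambda>u. if u \<in> dg_hat n \<mu> then fst u else undefined)"
    (is "_ = extensions n \<mu> _ ?\<tau>")
proof (rule set_eqI)
  fix \<sigma>
  have dg: "u \<in> dg_hat n \<mu> \<longleftrightarrow> u \<in> dg n \<mu> \<or> (\<exists>i\<in>{1..n}. u = (i, 0))" for u
    by (auto simp: dg_hat_def)
  show "\<sigma> \<in> NAF n id \<mu> \<longleftrightarrow> \<sigma> \<in> extensions n \<mu> (dg n \<mu>) ?\<tau>"
  proof
    assume \<sigma>: "\<sigma> \<in> NAF n id \<mu>"
    have att: "\<sigma> u \<noteq> \<sigma> w" if "u \<in> dg n \<mu>" "w \<in> attacked n \<mu> u" for u w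
    proof -
      have "attacking u w" using that(2) by (auto simp: attacked_def attacking_def)
      then show ?thesis using \<sigma> that by (auto simp: NAF_def attacked_def dg_hat_def)
    qed
    have "\<sigma> u = ?\<tau> u" if "u \<notin> dg n \<mu>" for u
    proof (cases "u \<in> dg_hat n \<mu>")
      case True
      then show ?thesis using \<sigma> that by (auto simp: NAF_def dg)
    next
      case False
      then show ?thesis using \<sigma> PiE_arb[of \<sigma> "dg_hat n \<mu>" _ u] by (auto simp: NAF_def)
    qed
    moreover have "\<sigma> u \<in> {1..n}" if "u \<in> dg n \<mu>" for u
      using \<sigma> that PiE_mem[of \<sigma> "dg_hat n \<mu>" _ u] by (auto simp: NAF_def dg)
    ultimately show "\<sigma> \<in> extensions n \<mu> (dg n \<mu>) ?\<tau>" using att unfolding extensions_def by blast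
  next
    assume \<sigma>: "\<sigma> \<in> extensions n \<mu> (dg n \<mu>) ?\<tau>"
    have base: "\<sigma> (i, 0) = i" if "i \<in> {1..n}" for i
      using \<sigma> that by (auto simp: extensions_def in_dg_iff in_dg_hat_iff)
    have up: "\<sigma> u \<in> {1..n}" "w \<in> attacked n \<mu> u \<Longrightarrow> \<sigma> u \<noteq> \<sigma> w" if "u \<in> dg n \<mu>" for u w
      using \<sigma> that unfolding extensions_def by blast+
    have "\<sigma> u \<noteq> \<sigma> v" if uv: "u \<in> dg_hat n \<mu>" "v \<in> dg_hat n \<mu>" "attacking u v" for u v
    proof -
      consider "u \<in> dg n \<mu>" "v \<in> attacked n \<mu> u" | "v \<in> dg n \<mu>" "u \<in> attacked n \<mu> v"
        | i k where "u = (i, 0)" "v = (k, 0)" "i \<in> {1..n}" "k \<in> {1..n}" "i \<noteq> k"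
        using uv by (cases u; cases v; cases "snd u"; cases "snd v")
          (auto simp: attacking_def attacked_def in_dg_iff in_dg_hat_iff neq_iff)
      then show ?thesis
      proof cases
        case 1
        then show ?thesis using up by blast
      next
        case 2
        then show ?thesis using up by metis
      next
        case 3
        then show ?thesis using base by simp
      qed
    qed
    moreover have "\<sigma> \<in> dg_hat n \<mu> \<rightarrow>\<^sub>E {1..n}"
    proof (rule PiE_I)
      fix u assume "u \<in> dg_hat n \<mu>"
      then consider "u \<in> dg n \<mu>" | i where "i \<in> {1..n}" "u = (i, 0)" unfolding dg by blast
      then show "\<sigma> u \<in> {1..n}" using up(1) base by cases simp_all
    next
      fix u assume u: "u \<notin> dg_hat n \<mu>"
      then have "u \<notin> dg n \<mu>" by (simp add: dg)
      then show "\<sigma> u = undefined" using extensions_outside[OF \<sigma>] u by simp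
    qed
    ultimately show "\<sigma> \<in> NAF n id \<mu>" using base by (auto simp: NAF_def)
  qed
qed

text \<open>At column 1 of row 1 only the basement is filled, so the frontier is the basement itself
  and every column has its full height remaining.\<close>

lemma macdonald_E_eq_gen_fun: "macdonald_E n \<mu> = gen_fun n (initial_state n id \<mu>)"
proof -
  let ?\<tau> = "\<lambda>u. if u \<in> dg_hat n \<mu> then fst u else undefined"
  have rem: "remaining n \<mu> 1 1 = dg n \<mu>" by (auto simp: remaining_def in_dg_iff)
  have "frontier n \<mu> 1 1 = map (\<lambda>k. (k, 0)) [1..<Suc n]"
    by (auto simp: frontier_def in_dg_hat_iff filter_id_conv simp del: upt_Suc)
  then have "frontier_state \<mu> ?\<tau> (frontier n \<mu> 1 1) = initial_state n id \<mu>"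
    by (auto simp: frontier_state_def initial_state_def leg_def in_dg_hat_iff simp del: upt_Suc)
  then show ?thesis
    using extension_sum_eq_gen_fun[of 1 n 1 \<mu> ?\<tau>]
    unfolding macdonald_E_eq_box_weights NAF_eq_extensions extension_sum_def rem by simp
qed

text \<open>The normalising power of t cancels the one collected along the reduced word.\<close>

lemma macdonald_E_perm_eq_gen_fun:
  assumes "\<pi> permutes {1..n}"
  shows "macdonald_E_perm n \<pi> \<mu> = gen_fun n (initial_state n \<pi> \<mu>)"
  by (simp add: macdonald_E_perm_def macdonald_E_eq_gen_fun demazure_lusztig_perm_initial_state[OF assms]
      mult.assoc[symmetric] cst.hom_mult[symmetric] power_int_minus)

theorem theorem3p9:
  fixes m n :: nat and \<pi>1 \<pi>2 \<mu> :: "nat \<Rightarrow> nat"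
  assumes "m < n"
    and "\<pi>1 permutes {1..m}"
    and "\<pi>2 permutes {m+1..n}"
  shows "macdonald_E_perm n
           (concat_perm m (compl_perm 1 m \<pi>1) (compl_perm (m+1) n \<pi>2)) \<mu>
       = cst (qq powi (- int (\<Sum>i=m+1..n. \<mu> i))) *
         subst_poly invert_qt
           (\<lambda>i. if i \<le> m then xvar (m + 1 - i) else cst qq * xvar (n + m + 1 - i))
           (macdonald_E_perm n (concat_perm m \<pi>1 \<pi>2) \<mu>)"
proof -
  define \<pi> where "\<pi> = concat_perm m \<pi>1 \<pi>2"
  define \<pi>c where "\<pi>c = concat_perm m (compl_perm 1 m \<pi>1) (compl_perm (m+1) n \<pi>2)"
  have mn: "m \<le> n" using assms(1) by simp
  have in1: "\<pi>1 k \<in> {1..m} \<longleftrightarrow> k \<in> {1..m}" and in2: "\<pi>2 k \<in> {m+1..n} \<longleftrightarrow> k \<in> {m+1..n}" for k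
    using permutes_in_image[OF assms(2)] permutes_in_image[OF assms(3)] by simp_all
  have out1: "k \<notin> {1..m} \<Longrightarrow> \<pi>1 k = k" and out2: "k \<notin> {m+1..n} \<Longrightarrow> \<pi>2 k = k" for k
    using permutes_not_in[OF assms(2)] permutes_not_in[OF assms(3)] by simp_all
  \<comment> \<open>The two factors have disjoint supports, so concatenation is composition and is
    therefore a permutation of {1..n}.\<close>
  have "\<pi> = \<pi>1 \<circ> \<pi>2"
  proof
    fix k
    consider "k \<in> {1..m}" | "k \<in> {m+1..n}" | "k \<notin> {1..m}" "k \<notin> {m+1..n}" by blast
    then show "\<pi> k = (\<pi>1 \<circ> \<pi>2) k"
    proof cases
      case 1
      then show ?thesis using out2[of k] by (simp add: \<pi>_def concat_perm_def)
    next
      case 2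
      then have "\<pi>2 k \<in> {m+1..n}" using in2 by blast
      then show ?thesis using 2 out1[of "\<pi>2 k"] by (simp add: \<pi>_def concat_perm_def)
    next
      case 3
      then show ?thesis using out1[of k] out2[of k] by (simp add: \<pi>_def concat_perm_def)
    qed
  qed
  moreover have "\<pi>1 permutes {1..n}" "\<pi>2 permutes {1..n}"
    using permutes_subset[OF assms(2)] permutes_subset[OF assms(3)] mn by auto
  ultimately have \<pi>: "\<pi> permutes {1..n}" by (simp add: permutes_compose)
  \<comment> \<open>Preservation of the blocks identifies the columns with upper basement value as
    those with index above \<open>m\<close>.\<close>
  have upper: "m < \<pi> k \<longleftrightarrow> m < k" if "k \<in> {1..n}" for k
    using in1[of k] in2[of k] that by (auto simp: \<pi>_def concat_perm_def)
  \<comment> \<open>Both complements become post-composition with the same map, so the two initial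
    states differ only by applying it to the values.\<close>
  have c: "\<pi>c k = block_compl m n (\<pi> k)" if "k \<in> {1..n}" for k
    using in1[of k] in2[of k] that
    by (auto simp: \<pi>c_def \<pi>_def concat_perm_def compl_perm_def block_compl_def)
  have c_out: "\<pi>c k = k" if "k \<notin> {1..n}" for k
    using that mn by (auto simp: \<pi>c_def concat_perm_def compl_perm_def)
  have "inj_on (block_compl m n \<circ> \<pi>) {1..n}"
    using comp_inj_on[OF permutes_inj_on[OF \<pi>], of "block_compl m n" "{1..n}"] block_compl_inj[OF mn]
    unfolding permutes_image[OF \<pi>] by blast
  moreover have "inj_on \<pi>c {1..n} \<longleftrightarrow> inj_on (block_compl m n \<circ> \<pi>) {1..n}"
    by (rule inj_on_cong) (simp only: c o_apply)
  moreover have "\<pi>c ` {1..n} = {1..n}"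
  proof -
    have "\<pi>c ` {1..n} = (\<lambda>k. block_compl m n (\<pi> k)) ` {1..n}"
      by (rule image_cong[OF refl]) (rule c)
    also have "\<dots> = block_compl m n ` \<pi> ` {1..n}" by (simp only: image_image)
    finally show ?thesis by (simp only: permutes_image[OF \<pi>] block_compl_image[OF mn])
  qed
  ultimately have \<pi>c: "\<pi>c permutes {1..n}"
    using c_out by (intro bij_imp_permutes) (auto simp: bij_betw_def)
  have state: "initial_state n \<pi>c \<mu> = map (apfst (block_compl m n)) (initial_state n \<pi> \<mu>)"
    using c by (simp add: initial_state_def del: upt_Suc)
  have "upper_height m (initial_state n \<pi> \<mu>) = (\<Sum>k\<leftarrow>[1..<Suc n]. if m < \<pi> k then \<mu> k else 0)"
    by (simp add: upper_height_def initial_state_def comp_def del: upt_Suc)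
  also have "\<dots> = (\<Sum>k\<in>{1..n}. if m < \<pi> k then \<mu> k else 0)"
    by (subst sum_list_distinct_conv_sum_set) (auto simp: atLeastLessThanSuc_atLeastAtMost simp del: upt_Suc)
  also have "\<dots> = (\<Sum>k\<in>{1..n}. if m < k then \<mu> k else 0)"
    using upper by (intro sum.cong) auto
  also have "\<dots> = (\<Sum>k=m+1..n. \<mu> k)"
    by (subst sum.inter_filter[symmetric]) (auto intro!: sum.cong)
  finally have p: "upper_height m (initial_state n \<pi> \<mu>) = (\<Sum>k=m+1..n. \<mu> k)" .
  have "distinct (map fst (initial_state n \<pi> \<mu>))" "fst ` set (initial_state n \<pi> \<mu>) \<subseteq> {1..n}"
    using permutes_inj_on[OF \<pi>] permutes_in_image[OF \<pi>]
    by (auto simp: initial_state_def comp_def distinct_map simp del: upt_Suc)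
  then have "gen_fun n (initial_state n \<pi>c \<mu>)
      = cst (qq powi (- int (\<Sum>k=m+1..n. \<mu> k))) * block_subst m n (gen_fun n (initial_state n \<pi> \<mu>))"
    unfolding state p[symmetric] by (rule gen_fun_block_compl[OF mn])
  then show ?thesis
    unfolding \<pi>_def[symmetric] \<pi>c_def[symmetric]
      macdonald_E_perm_eq_gen_fun[OF \<pi>] macdonald_E_perm_eq_gen_fun[OF \<pi>c] .
qed

end
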